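(* Let $I=[a,b]$, $r,s\in\mathbb{N}$ with $s\le r$, $1\le p<\infty$, $\gamma\in(0,1]$, and for each $n\in\mathbb{N}$ let $X_n=(x_{k,n})_{k=0}^n\subset[a,b]$ be a set of points with $x_{0,n}<\dots<x_{n,n}$ and $\min_k(x_{k+1,n}-x_{k,n})\ge\gamma/n$. Let $G_n(f)(x)=\sum_{k=0}^n f(x_{k,n})\varphi_{k,n}(x)$, $n\in\mathbb{N}$. Assume that there are constants $K_1=K_1(p)>0$ and $K_3=K_3(s,p)>0$ (independent of $f$ and $n$) such that for all $n\in\mathbb{N}$ $$\|G_n(f)\|_p\le K_1\|f\|_{\ell_p(X_n)}\quad(f\in L^p(I)),\qquad\|f-G_n(f)\|_p\le K_3n^{-s}\|f^{(s)}\|_p\quad(f\in W^s_p(I)).$$ Then there is a constant $C_1>0$, not depending on $f$ and $n$, such that for every $f\in L^p(I)$ and every $n\in\mathbb{N}$ with $\gamma/n\le(b-a)/r$ $$\|f-G_n(f)\|_p\le K_1\|\tilde f_{\gamma/n,r}-f\|_{\ell_p(X_n)}+C_1\,\omega_s(f,1/n)_p,$$ and in particular $$\|f-G_n(f)\|_p\le\max\{K_1,C_1\}\,\tilde\Omega_{r,s}\left(f,\tfrac\gamma n,X_n\right)_p.$$ Moreover, if in addition there is a constant $K_2=K_2(p)>0$ with $K_2\|f\|_{\ell_p(X_n)}\le\|G_n(f)\|_p$ for all $f\in L^p(I)$ and $n\in\mathbb{N}$, then for the same $f$ and $n$ $$K_2\|\tilde f_{\gamma/n,r}-f\|_{\e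ll_p(X_n)}-C_1\,\omega_s(f,1/n)_p\le\|f-G_n(f)\|_p.$$
   Context: Conventions: $\mathbb{N}=\{1,2,\dots\}$; $L^p(I)$ consists of pointwise defined functions (functions equal almost everywhere are not identified); $\|\cdot\|_p$ is the $L^p(I)$ norm. $W^s_p(I)$ is the usual Sobolev space, whose elements are taken as functions $g$ with $g,\dots,g^{(s-1)}$ absolutely continuous on $I$ and $g^{(s)}\in L^p(I)$. The $\varphi_{k,n}$ are functions on $I$. In $\min_k(x_{k+1,n}-x_{k,n})$ one sets $x_{n+1,n}=(b-a)+x_{1,n}$. Discrete semi-norm: $\|f\|_{\ell_p(X_n)}=\big(\frac{b-a}{n}\sum_{k=0}^n|f(x_{k,n})|^p\big)^{1/p}$. Modulus of smoothness: $\Delta_h^sf(x)=\sum_{k=0}^s\binom sk(-1)^{s-k}f(x+kh)$, $\omega_s(f,\delta)_p=\sup_{0<h\le\delta}\big(\int_a^{b-sh}|\Delta_h^sf(x)|^p\,dx\big)^{1/p}$ (the integral is $0$ if $sh\ge b-a$). Steklov averages, for $0<\delta\le(b-a)/r$: $\tilde f_{\delta,r}(x)=(-\delta)^{-r}\int_0^\delta\cdots\int_0^\delta\sum_{m=1}^r(-1)^{r-m+1}\binom r{r-m}f(x+m\theta_x)\,dt_1\cdots dt_r$, with $\theta_x=\frac{t_1+\dots+t_r}{r}-\frac{x-a}{b-a}\delta$. Semi-discrete modulus: $\tilde\Omega_{r,s}(f,\frac\gamma n,X_n)_p=\|\tilde f_{\gamma/n,r}-f\|_{\ell_p(X_n)}+\omega_s(f,1/n)_p$.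 *)

theory Defs
  imports "HOL-Analysis.Analysis"
begin

text \<open>
  Functions on \<open>I = [a, b]\<close> are represented by functions \<open>real \<Rightarrow> real\<close> of which only the values
  on \<open>{a..b}\<close> are used. Measurability and integrals are with respect to Lebesgue measure
  (not its restriction to the Borel sets).
\<close>

definition Lp_space :: "real \<Rightarrow> real \<Rightarrow> real \<Rightarrow> (real \<Rightarrow> real) set" where
  "Lp_space p a b =
     {f. f \<in> borel_measurable (lebesgue_on {a..b}) \<and>
         integrable (lebesgue_on {a..b}) (\<lambda>x. \<bar>f x\<bar> powr p)}"

text \<open>
  A Bochner integral is \<open>0\<close> when the integrand is not integrable, so this is the norm only for
  members of \<open>Lp_space p a b\<close>.
\<close>

definition Lp_norm :: "real \<Rightarrow> real \<Rightarrow> real \<Rightarrow> (real \<Rightarrow> real) \<Rightarrow> real" where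
  "Lp_norm p a b f = (LINT x|lebesgue_on {a..b}. \<bar>f x\<bar> powr p) powr (1 / p)"

definition abs_continuous_on_Icc :: "real \<Rightarrow> real \<Rightarrow> (real \<Rightarrow> real) \<Rightarrow> bool" where
  "abs_continuous_on_Icc a b f \<longleftrightarrow>
     (\<forall>e>0. \<exists>d>0. \<forall>(N::nat) u v.
        (\<forall>i<N. a \<le> u i \<and> u i \<le> v i \<and> v i \<le> b) \<and>
        (\<forall>i<N. \<forall>j<N. i \<noteq> j \<longrightarrow> {u i<..<v i} \<inter> {u j<..<v j} = {}) \<and>
        (\<Sum>i<N. v i - u i) < d
        \<longrightarrow> (\<Sum>i<N. \<bar>f (v i) - f (u i)\<bar>) < e)"

text \<open>
  Derivatives are taken within \<open>{a..b}\<close>, hence one-sided at the endpoints. At points where the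
  function is not differentiable the value is arbitrary; for \<open>g\<close> in the Sobolev space below,
  the derivative of order \<open>s\<close> has this defect on a null set only.
\<close>

definition iter_deriv :: "real \<Rightarrow> real \<Rightarrow> nat \<Rightarrow> (real \<Rightarrow> real) \<Rightarrow> real \<Rightarrow> real" where
  "iter_deriv a b j g = ((\<lambda>h x. vector_derivative h (at x within {a..b})) ^^ j) g"

definition Sobolev_space :: "nat \<Rightarrow> real \<Rightarrow> real \<Rightarrow> real \<Rightarrow> (real \<Rightarrow> real) set" where
  "Sobolev_space s p a b =
     {g. (\<forall>j. Suc j < s \<longrightarrow> iter_deriv a b j g differentiable_on {a..b}) \<and>
         (\<forall>j<s. abs_continuous_on_Icc a b (iter_deriv a b j g)) \<and>
         iter_deriv a b s g \<in> Lp_space p a b}"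

text \<open>A family of nodes is \<open>x k n\<close>, the \<open>k\<close>-th node of \<open>X\<^sub>n\<close> for \<open>k \<le> n\<close>.\<close>

definition ext_node :: "real \<Rightarrow> real \<Rightarrow> (nat \<Rightarrow> nat \<Rightarrow> real) \<Rightarrow> nat \<Rightarrow> nat \<Rightarrow> real" where
  "ext_node a b x k n = (if k = n + 1 then (b - a) + x 1 n else x k n)"

definition lp_seminorm ::
    "real \<Rightarrow> real \<Rightarrow> real \<Rightarrow> (nat \<Rightarrow> nat \<Rightarrow> real) \<Rightarrow> nat \<Rightarrow> (real \<Rightarrow> real) \<Rightarrow> real" where
  "lp_seminorm p a b x n f =
     ((b - a) / real n * (\<Sum>k=0..n. \<bar>f (x k n)\<bar> powr p)) powr (1 / p)"

definition sampling_op ::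
    "(nat \<Rightarrow> nat \<Rightarrow> real) \<Rightarrow> (nat \<Rightarrow> nat \<Rightarrow> real \<Rightarrow> real) \<Rightarrow> nat \<Rightarrow> (real \<Rightarrow> real) \<Rightarrow> real \<Rightarrow> real" where
  "sampling_op x \<phi> n f = (\<lambda>y. \<Sum>k=0..n. f (x k n) * \<phi> k n y)"

definition fwd_diff :: "nat \<Rightarrow> real \<Rightarrow> (real \<Rightarrow> real) \<Rightarrow> real \<Rightarrow> real" where
  "fwd_diff s h f x = (\<Sum>k=0..s. real (s choose k) * (-1) ^ (s - k) * f (x + real k * h))"

text \<open>
  For \<open>s h \<ge> b - a\<close> the domain of integration is empty or a single point, so the integral is \<open>0\<close>.
  For \<open>f \<in> Lp_space p a b\<close> the supremum is over a bounded set.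
\<close>

definition modulus_smoothness ::
    "nat \<Rightarrow> real \<Rightarrow> real \<Rightarrow> real \<Rightarrow> (real \<Rightarrow> real) \<Rightarrow> real \<Rightarrow> real" where
  "modulus_smoothness s p a b f \<delta> =
     (SUP h\<in>{0<..\<delta>}.
        (LINT x:{a..b - real s * h}|lebesgue. \<bar>fwd_diff s h f x\<bar> powr p) powr (1 / p))"

text \<open>
  The \<open>r\<close>-fold iterated integral over \<open>[0, \<delta>]\<close> of a function of \<open>(t\<^sub>1, \<dots>, t\<^sub>r)\<close>, given as a
  function of the list \<open>[t\<^sub>1, \<dots>, t\<^sub>r]\<close>. Iterated integrals, rather than an integral with respect to
  a product measure, are needed because \<open>f\<close> is only Lebesgue measurable.
\<close>

primrec iter_integral :: "real \<Rightarrow> nat \<Rightarrow> (real list \<Rightarrow> real) \<Rightarrow> real" where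
  "iter_integral \<delta> 0 g = g []"
| "iter_integral \<delta> (Suc r) g =
     (LINT t:{0..\<delta>}|lebesgue. iter_integral \<delta> r (\<lambda>ts. g (t # ts)))"

definition steklov_theta :: "real \<Rightarrow> real \<Rightarrow> real \<Rightarrow> nat \<Rightarrow> real \<Rightarrow> real list \<Rightarrow> real" where
  "steklov_theta a b \<delta> r x ts = sum_list ts / real r - (x - a) / (b - a) * \<delta>"

definition steklov :: "real \<Rightarrow> real \<Rightarrow> real \<Rightarrow> nat \<Rightarrow> (real \<Rightarrow> real) \<Rightarrow> real \<Rightarrow> real" where
  "steklov a b \<delta> r f x =
     (- \<delta>) powi (- int r) *
     iter_integral \<delta> r
       (\<lambda>ts. \<Sum>m=1..r. (-1) ^ (r - m + 1) * real (r choose (r - m)) *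
                f (x + real m * steklov_theta a b \<delta> r x ts))"

definition semidiscrete_modulus ::
    "nat \<Rightarrow> nat \<Rightarrow> real \<Rightarrow> real \<Rightarrow> real \<Rightarrow> (nat \<Rightarrow> nat \<Rightarrow> real) \<Rightarrow> real \<Rightarrow> nat \<Rightarrow> (real \<Rightarrow> real) \<Rightarrow> real" where
  "semidiscrete_modulus r s p a b x \<gamma> n f =
     lp_seminorm p a b x n (\<lambda>y. steklov a b (\<gamma> / real n) r f y - f y)
     + modulus_smoothness s p a b f (1 / real n)"

end

theory Submission
  imports Defs
begin

text \<open>
  Let \<open>F\<close> be the Steklov average of \<open>f\<close> with step \<open>\<delta> = \<gamma> / n\<close> and let \<open>G\<close> be the sampling operator.
  Both inequalities come from the splitting
  \<open>f - G f = (f - F) + (F - G F) + G (F - f)\<close>. The last summand is controlled by the discrete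
  semi-norm, from above by the assumption on \<open>G\<close> and from below by the assumption with \<open>K2\<close>. The
  first two summands are at most a constant times the modulus \<open>\<omega>\<close> of order \<open>s\<close> of \<open>f\<close> at \<open>1 / n\<close>;
  this is where \<open>C1\<close> arises, and it rests on two properties of \<open>F\<close>.

  \<^bold>\<open>\<open>F\<close> is close to \<open>f\<close>\<close> (\<open>steklov_minus_Lp_le\<close>). At a point \<open>x\<close>, the difference \<open>F x - f x\<close> is, up to sign,
  a mean of differences of order \<open>r\<close> of \<open>f\<close> at \<open>x\<close> whose steps fill an interval of length \<open>\<delta>\<close>
  inside \<open>[-\<delta>, \<delta>]\<close>. The interval depends on \<open>x\<close> in such a way that all points that are used remain in
  \<open>[a, b]\<close>. By Jensen's inequality and Tonelli's theorem, the \<open>p\<close>-th power of the norm is at most a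
  constant times a mean, over \<open>h\<close>, of the \<open>p\<close>-th powers of the norms of the differences with fixed step \<open>h\<close>. Differences
  of order \<open>r\<close> are differences of order \<open>s\<close> of which \<open>r - s\<close> further differences are taken, each of
  which at most doubles the norm.

  \<^bold>\<open>\<open>F\<close> is smooth\<close> (\<open>steklov_Sobolev_space\<close>). \<open>F\<close> is a sum over \<open>m = 1, \<dots>, r\<close> of \<open>r\<close>-fold sliding integrals
  of \<open>f\<close>, composed with affine maps of \<open>[a, b]\<close> into \<open>[a, b - m \<delta>]\<close>. Differentiating a sliding integral replaces
  it by a difference quotient, so the derivative of order \<open>s\<close> consists of differences of order \<open>s\<close>
  with step \<open>m \<delta> / r \<le> \<delta>\<close>, integrated \<open>r - s\<close> more times. Its norm is therefore at most a multiple
  of \<open>\<omega> / \<delta> ^ s\<close>, and the factor \<open>n powi (- s)\<close> in the Jackson estimate cancels \<open>\<delta> ^ s = (\<gamma> / n) ^ s\<close>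
  up to the constant \<open>\<gamma> ^ s\<close>.

  For \<open>s = r\<close> the derivative of order \<open>s\<close> exists in general only almost everywhere. It is identified by Lebesgue's
  differentiation theorem (\<open>primitive_on_derivative_AE\<close>), which follows from Henstock's lemma and
  Vitali's covering theorem. Tonelli's theorem needs joint measurability, so these estimates are proved
  for Borel functions. Norms, moduli and, at every point of \<open>[a, b]\<close>, Steklov averages depend only on the
  values of \<open>f\<close> outside a null set, which allows the passage to Lebesgue measurable functions
  (\<open>steklov_estimates\<close>).
\<close>

section \<open>Norm bounds in Lebesgue spaces\<close>

text \<open>
  The bound \<open>\<parallel>u\<parallel> \<le> C\<close> in \<open>L\<^sup>p(M)\<close>. With a nonnegative integral it includes the membership of \<open>u\<close>, and
  Tonelli's theorem applies without integrability conditions.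
\<close>
definition Lp_le :: "real \<Rightarrow> 'a measure \<Rightarrow> ('a \<Rightarrow> real) \<Rightarrow> real \<Rightarrow> bool" where
  "Lp_le p M u C \<longleftrightarrow> 0 \<le> C \<and> u \<in> borel_measurable M \<and>
     (\<integral>\<^sup>+x. ennreal (\<bar>u x\<bar> powr p) \<partial>M) \<le> ennreal (C powr p)"

lemma powr_convex_nonneg:
  fixes p :: real
  assumes "1 \<le> p"
  shows "convex_on {0..} (\<lambda>x. x powr p)"
proof (rule convex_onI)
  fix t x y :: real
  assume t: "0 < t" "t < 1" and xy: "x \<in> {0..}" "y \<in> {0..}"
  have small: "c powr p \<le> c" if "0 < c" "c < 1" for c :: real
    using powr_mono'[of 1 p c] that assms by simp
  consider "x = 0" | "y = 0" | "x > 0" "y > 0"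
    using xy by fastforce
  then show "((1 - t) *\<^sub>R x + t *\<^sub>R y) powr p \<le> (1 - t) * x powr p + t * y powr p"
  proof cases
    case 1
    then show ?thesis using small[of t] t xy assms
      by (simp add: powr_mult mult_right_mono)
  next
    case 2
    then show ?thesis using small[of "1 - t"] t xy assms
      by (simp add: powr_mult mult_right_mono)
  next
    case 3
    then show ?thesis
      using convex_onD[OF powr_convex[OF assms], of t x y] t by simp
  qed
qed auto

text \<open>
  Integrated, with \<open>y\<close> the mean of a function, this tangent inequality is Jensen's inequality.
\<close>
lemma powr_ge_tangent:
  fixes p x y :: real
  assumes "1 \<le> p" "0 \<le> x" "0 < y"
  shows "x powr p \<ge> y powr p + p * y powr (p - 1) * (x - y)"
proof (cases "x = 0")
  case True
  have "y powr (p - 1) * y = y powr p"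
    using assms by (simp add: powr_diff)
  moreover have "1 * y powr p \<le> p * y powr p"
    using assms by (intro mult_right_mono) auto
  ultimately show ?thesis using True assms
    by (simp add: algebra_simps)
next
  case False
  have "(\<lambda>x. x powr p) x - (\<lambda>x. x powr p) y \<ge> (p * y powr (p - 1)) * (x - y)"
  proof (rule convex_on_imp_above_tangent)
    show "convex_on {0<..} (\<lambda>x. x powr p)" using assms by (intro powr_convex)
    show "((\<lambda>x. x powr p) has_field_derivative p * y powr (p - 1)) (at y within {0<..})"
      using assms by (auto intro!: derivative_eq_intros)
  qed (use assms False in \<open>auto simp: interior_open\<close>)
  then show ?thesis by simp
qed

lemma Lp_le_mono: "Lp_le p M u C \<Longrightarrow> C \<le> D \<Longrightarrow> 1 \<le> p \<Longrightarrow> Lp_le p M u D"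
  unfolding Lp_le_def using order_trans[OF _ ennreal_leI[OF powr_mono2[of p C D]]] by fastforce

text \<open>
  Used to avoid division by a vanishing norm in the proof of Minkowski's inequality.
\<close>
lemma Lp_le_limit:
  assumes "\<And>e. 0 < e \<Longrightarrow> Lp_le p M u (C + e)" "0 \<le> C" "1 \<le> p"
  shows "Lp_le p M u C"
proof -
  have "((\<lambda>e. ennreal ((C + e) powr p)) \<longlongrightarrow> ennreal ((C + 0) powr p)) (at_right 0)"
    using assms by (intro tendsto_ennrealI tendsto_powr2 tendsto_intros) (auto simp: eventually_at_right_less
        eventually_at_filter)
  moreover have "\<forall>\<^sub>F e in at_right 0. (\<integral>\<^sup>+x. ennreal (\<bar>u x\<bar> powr p) \<partial>M) \<le> ennreal ((C + e) powr p)"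
    using eventually_at_right_less[of "0::real"] by eventually_elim (use assms in \<open>auto simp: Lp_le_def\<close>)
  ultimately have "(\<integral>\<^sup>+x. ennreal (\<bar>u x\<bar> powr p) \<partial>M) \<le> ennreal (C powr p)"
    by (intro tendsto_lowerbound[of _ _ "at_right (0::real)"]) auto
  then show ?thesis using assms(1)[of 1] assms(2) by (auto simp: Lp_le_def)
qed

text \<open>
  Minkowski's inequality, from convexity: \<open>(\<bar>u\<bar> + \<bar>v\<bar>) / (C + D)\<close> is the convex combination of
  \<open>\<bar>u\<bar> / C\<close> and \<open>\<bar>v\<bar> / D\<close> with weights proportional to \<open>C\<close> and \<open>D\<close>.
\<close>
lemma Lp_le_add:
  assumes u: "Lp_le p M u C" and v: "Lp_le p M v D" and p: "1 \<le> p"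
  shows "Lp_le p M (\<lambda>x. u x + v x) (C + D)"
proof -
  have [measurable]: "u \<in> borel_measurable M" "v \<in> borel_measurable M"
    and CD: "0 \<le> C" "0 \<le> D"
    using u v by (auto simp: Lp_le_def)
  have pos: "Lp_le p M (\<lambda>x. u x + v x) (C + D)"
    if u: "Lp_le p M u C" and v: "Lp_le p M v D" and CD: "0 < C" "0 < D" for C D
  proof -
    define l where "l = D / (C + D)"
    have l: "0 \<le> l" "l \<le> 1" "1 - l = C / (C + D)"
      using CD by (auto simp: l_def field_simps)
    define \<alpha> where "\<alpha> = (C + D) powr p * ((1 - l) * C powr (- p))"
    define \<beta> where "\<beta> = (C + D) powr p * (l * D powr (- p))"
    have \<alpha>\<beta>: "0 \<le> \<alpha>" "0 \<le> \<beta>" "\<alpha> * C powr p + \<beta> * D powr p = (C + D) powr p"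
      using l(1,2) CD by (auto simp: \<alpha>_def \<beta>_def powr_minus field_simps)
    have pt: "\<bar>u x + v x\<bar> powr p \<le>
      \<alpha> * \<bar>u x\<bar> powr p
      + \<beta> * \<bar>v x\<bar> powr p" for x
    proof -
      have "\<bar>u x + v x\<bar> powr p \<le> (\<bar>u x\<bar> + \<bar>v x\<bar>) powr p"
        using p by (intro powr_mono2) auto
      also have "\<bar>u x\<bar> + \<bar>v x\<bar> = (C + D) * ((1 - l) * (\<bar>u x\<bar> / C) + l * (\<bar>v x\<bar> / D))"
      proof -
        have "(1 - l) * (\<bar>u x\<bar> / C) = \<bar>u x\<bar> / (C + D)" using CD unfolding l(3) by simp
        moreover have "l * (\<bar>v x\<bar> / D) = \<bar>v x\<bar> / (C + D)" using CD unfolding l_def by simp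
        moreover have "(C + D) * (\<bar>u x\<bar> / (C + D) + \<bar>v x\<bar> / (C + D)) = \<bar>u x\<bar> + \<bar>v x\<bar>"
          using CD by (simp add: add_divide_distrib[symmetric])
        ultimately show ?thesis by simp
      qed
      also have "\<dots> powr p = (C + D) powr p * ((1 - l) * (\<bar>u x\<bar> / C) + l * (\<bar>v x\<bar> / D)) powr p"
        using CD l by (simp add: powr_mult)
      also have "\<dots> \<le> (C + D) powr p *
          ((1 - l) * (\<bar>u x\<bar> / C) powr p + l * (\<bar>v x\<bar> / D) powr p)"
        using convex_onD[OF powr_convex_nonneg[OF p], of l "\<bar>u x\<bar> / C" "\<bar>v x\<bar> / D"] l CD
        by (intro mult_left_mono) auto
      finally show ?thesis
        using CD by (simp add: \<alpha>_def \<beta>_def powr_divide powr_minus_divide algebra_simps)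
    qed
    have "(\<integral>\<^sup>+x. ennreal (\<bar>u x + v x\<bar> powr p) \<partial>M) \<le>
      (\<integral>\<^sup>+x. ennreal \<alpha> * ennreal (\<bar>u x\<bar> powr p)
      + ennreal \<beta> * ennreal (\<bar>v x\<bar> powr p) \<partial>M)"
      using pt \<alpha>\<beta> by (intro nn_integral_mono)
        (simp add: ennreal_mult[symmetric] ennreal_plus[symmetric] del: ennreal_plus)
    also have "\<dots> = ennreal \<alpha> * (\<integral>\<^sup>+x. ennreal (\<bar>u x\<bar> powr p) \<partial>M)
      + ennreal \<beta> * (\<integral>\<^sup>+x. ennreal (\<bar>v x\<bar> powr p) \<partial>M)"
      by (simp add: nn_integral_add nn_integral_cmult)
    also have "\<dots> \<le> ennreal \<alpha> * ennreal (C powr p)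
      + ennreal \<beta> * ennreal (D powr p)"
      using u v by (intro add_mono mult_left_mono) (auto simp: Lp_le_def)
    also have "\<dots> = ennreal ((C + D) powr p)"
      using \<alpha>\<beta> by (simp add: ennreal_mult[symmetric] ennreal_plus[symmetric] del: ennreal_plus)
    finally show ?thesis using CD by (simp add: Lp_le_def)
  qed
  \<comment> \<open>enlarging both bounds covers the case that one of them is \<open>0\<close>\<close>
  show ?thesis
  proof (rule Lp_le_limit)
    fix e :: real assume e: "0 < e"
    have "Lp_le p M (\<lambda>x. u x + v x) ((C + e/2) + (D + e/2))"
      using e CD p by (intro pos Lp_le_mono[OF u] Lp_le_mono[OF v]) auto
    then show "Lp_le p M (\<lambda>x. u x + v x) (C + D + e)" by (simp add: algebra_simps)
  qed (use CD p in auto)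
qed

lemma Lp_le_cmult:
  assumes "Lp_le p M u C"
  shows "Lp_le p M (\<lambda>x. c * u x) (\<bar>c\<bar> * C)"
proof -
  have [measurable]: "u \<in> borel_measurable M" and C: "0 \<le> C"
    using assms by (auto simp: Lp_le_def)
  have "(\<integral>\<^sup>+x. ennreal (\<bar>c * u x\<bar> powr p) \<partial>M) = (\<integral>\<^sup>+x. ennreal (\<bar>c\<bar> powr p) * ennreal (\<bar>u x\<bar> powr p) \<partial>M)"
    by (simp add: abs_mult powr_mult ennreal_mult)
  also have "\<dots> = ennreal (\<bar>c\<bar> powr p) * (\<integral>\<^sup>+x. ennreal (\<bar>u x\<bar> powr p) \<partial>M)"
    by (simp add: nn_integral_cmult)
  also have "\<dots> \<le> ennreal (\<bar>c\<bar> powr p) * ennreal (C powr p)"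
    using assms by (intro mult_left_mono) (auto simp: Lp_le_def)
  also have "\<dots> = ennreal ((\<bar>c\<bar> * C) powr p)"
    using C by (simp add: powr_mult ennreal_mult)
  finally show ?thesis using C by (simp add: Lp_le_def)
qed

lemma Lp_le_uminus: "Lp_le p M u C \<Longrightarrow> Lp_le p M (\<lambda>x. - u x) C"
  using Lp_le_cmult[of p M u C "-1"] by simp

lemma Lp_le_diff:
  "Lp_le p M u C \<Longrightarrow> Lp_le p M v D \<Longrightarrow> 1 \<le> p \<Longrightarrow> Lp_le p M (\<lambda>x. u x - v x) (C + D)"
  using Lp_le_add[of p M u C "\<lambda>x. - v x" D] Lp_le_uminus[of p M v D] by simp

lemma Lp_le_zero: "1 \<le> p \<Longrightarrow> Lp_le p M (\<lambda>x. 0) 0"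
  by (simp add: Lp_le_def)

lemma Lp_le_sum:
  assumes "finite A" "\<And>i. i \<in> A \<Longrightarrow> Lp_le p M (u i) (C i)" "1 \<le> p"
  shows "Lp_le p M (\<lambda>x. \<Sum>i\<in>A. u i x) (\<Sum>i\<in>A. C i)"
  using assms by (induction A rule: finite_induct) (simp_all add: Lp_le_zero Lp_le_add)

lemma Lp_le_cong_AE:
  assumes "Lp_le p M u C" "AE x in M. u x = v x" "v \<in> borel_measurable M"
  shows "Lp_le p M v C"
proof -
  have "(\<integral>\<^sup>+x. ennreal (\<bar>v x\<bar> powr p) \<partial>M) = (\<integral>\<^sup>+x. ennreal (\<bar>u x\<bar> powr p) \<partial>M)"
    using assms(2) by (intro nn_integral_cong_AE) auto
  then show ?thesis using assms by (simp add: Lp_le_def)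
qed

lemma Lp_le_iff_norm:
  assumes "1 \<le> p"
  shows "Lp_le p M u C \<longleftrightarrow> u \<in> borel_measurable M \<and> integrable M (\<lambda>x. \<bar>u x\<bar> powr p) \<and>
     (LINT x|M. \<bar>u x\<bar> powr p) powr (1 / p) \<le> C"
proof safe
  assume L: "Lp_le p M u C"
  then show [measurable]: "u \<in> borel_measurable M" by (simp add: Lp_le_def)
  have C: "0 \<le> C" using L by (simp add: Lp_le_def)
  show i: "integrable M (\<lambda>x. \<bar>u x\<bar> powr p)"
    using L by (intro integrableI_bounded) (auto simp: Lp_le_def top.not_eq_extremum elim!: le_less_trans)
  have "(LINT x|M. \<bar>u x\<bar> powr p) \<le> C powr p"
    using L nn_integral_eq_integral[OF i] by (simp add: Lp_le_def)
  then have "(LINT x|M. \<bar>u x\<bar> powr p) powr (1 / p) \<le> (C powr p) powr (1 / p)"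
    using assms by (intro powr_mono2 integral_nonneg_AE) auto
  also have "\<dots> = C" using C assms by (simp add: powr_powr)
  finally show "(LINT x|M. \<bar>u x\<bar> powr p) powr (1 / p) \<le> C" .
next
  assume u: "u \<in> borel_measurable M" and i: "integrable M (\<lambda>x. \<bar>u x\<bar> powr p)"
    and le: "(LINT x|M. \<bar>u x\<bar> powr p) powr (1 / p) \<le> C"
  have n: "0 \<le> (LINT x|M. \<bar>u x\<bar> powr p)" by (intro integral_nonneg_AE) auto
  have C: "0 \<le> C" using le order_trans[OF powr_ge_zero] by blast
  have "((LINT x|M. \<bar>u x\<bar> powr p) powr (1 / p)) powr p \<le> C powr p"
    using le assms by (intro powr_mono2) auto
  moreover have "((LINT x|M. \<bar>u x\<bar> powr p) powr (1 / p)) powr p = (LINT x|M. \<bar>u x\<bar> powr p)"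
    using n assms by (simp add: powr_powr)
  ultimately show "Lp_le p M u C"
    using u C nn_integral_eq_integral[OF i] by (simp add: Lp_le_def ennreal_leI)
qed

lemma Lp_le_iff_Lp_space:
  "1 \<le> p \<Longrightarrow> Lp_le p (lebesgue_on {a..b}) u C \<longleftrightarrow> u \<in> Lp_space p a b \<and> Lp_norm p a b u \<le> C"
  unfolding Lp_le_iff_norm Lp_space_def Lp_norm_def by auto

text \<open>
  Jensen's inequality for a finite measure that need not be normalised. Where the right-hand side is
  infinite there is nothing to prove; otherwise the tangent at the mean \<open>A\<close> of \<open>\<bar>w\<bar>\<close> is integrated.
\<close>
lemma ennreal_powr_integral_le:
  fixes w :: "'a \<Rightarrow> real"
  assumes M: "finite_measure M" and w: "integrable M w" and p: "1 \<le> p"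
  shows "ennreal (\<bar>LINT x|M. w x\<bar> powr p) \<le>
     ennreal (measure M (space M) powr (p - 1)) * (\<integral>\<^sup>+x. ennreal (\<bar>w x\<bar> powr p) \<partial>M)"
proof -
  interpret finite_measure M by fact
  define m where "m = measure M (space M)"
  define I where "I = (LINT x|M. \<bar>w x\<bar>)"
  have [measurable]: "w \<in> borel_measurable M" using w by auto
  have m0: "0 \<le> m" by (simp add: m_def)
  have leI: "\<bar>LINT x|M. w x\<bar> \<le> I" unfolding I_def by (rule integral_abs_bound)
  show ?thesis
  proof (cases "I = 0")
    case True
    then show ?thesis using leI p by simp
  next
    case False
    then have I: "0 < I" using leI by linarith
    have m: "0 < m"
    proof (rule ccontr)
      assume "\<not> 0 < m"
      then have "emeasure M (space M) = 0" using m0 by (simp add: emeasure_eq_measure m_def antisym_conv1 not_less order.antisym)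
      then have "AE x in M. x \<notin> space M" by (intro AE_I[of _ _ "space M"]) auto
      then have "AE x in M. \<bar>w x\<bar> = 0" using AE_space by eventually_elim auto 
      then have "I = 0" unfolding I_def by (rule integral_eq_zero_AE)
      then show False using I by simp
    qed
    define A where "A = I / m"
    have A: "0 < A" using I m by (simp add: A_def)
    have main: "ennreal (I powr p) \<le> ennreal (m powr (p - 1)) * (\<integral>\<^sup>+x. ennreal (\<bar>w x\<bar> powr p) \<partial>M)"
    proof (cases "(\<integral>\<^sup>+x. ennreal (\<bar>w x\<bar> powr p) \<partial>M) = \<infinity>")
      case True
      then show ?thesis using m by (simp add: ennreal_mult_top)
    next
      case False
      then have i: "integrable M (\<lambda>x. \<bar>w x\<bar> powr p)"
        by (intro integrableI_bounded) (auto simp: top.not_eq_extremum)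
      have "(LINT x|M. A powr p + p * A powr (p - 1) * (\<bar>w x\<bar> - A)) \<le> (LINT x|M. \<bar>w x\<bar> powr p)"
        using powr_ge_tangent[OF p _ A] i w by (intro integral_mono) auto
      moreover have "(LINT x|M. A powr p + p * A powr (p - 1) * (\<bar>w x\<bar> - A)) = A powr p * m"
        using w m by (simp add: I_def[symmetric] m_def[symmetric]) (simp add: A_def)
      moreover have "A powr p * m * m powr (p - 1) = I powr p"
        using I m by (simp add: A_def powr_divide powr_diff)
      ultimately have "I powr p \<le> m powr (p - 1) * (LINT x|M. \<bar>w x\<bar> powr p)"
        using m by (smt (verit) mult.commute mult_right_mono powr_ge_zero)
      then show ?thesis using nn_integral_eq_integral[OF i]
        by (simp add: ennreal_mult[symmetric] ennreal_leI integral_nonneg_AE)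
    qed
    have "ennreal (\<bar>LINT x|M. w x\<bar> powr p) \<le> ennreal (I powr p)"
      using leI p by (intro ennreal_leI powr_mono2) auto
    then show ?thesis using main unfolding m_def by (rule order_trans)
  qed
qed

section \<open>Differentiation of indefinite integrals\<close>

text \<open>
  The key to Lebesgue's differentiation theorem: the set \<open>B\<close> of points where difference quotients over
  arbitrarily short intervals miss \<open>h x\<close> by at least \<open>e\<close> is a null set. By Vitali's theorem, disjoint
  such intervals cover almost all of \<open>B\<close>. Tagged with the points of \<open>B\<close>, finitely many of them form
  a partial division, for which Henstock's lemma makes the sum of the errors less than \<open>e * \<epsilon>\<close>. As
  each error is at least \<open>e\<close> times the length, the total length is at most \<open>\<epsilon>\<close>.
\<close>
lemma negligible_large_difference_quotient:
  fixes h :: "real \<Rightarrow> real"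
  assumes h: "h integrable_on {a..b}" and e: "0 < e"
    and B: "\<And>x d. x \<in> B \<Longrightarrow> 0 < d \<Longrightarrow> \<exists>u v. a \<le> u \<and> u < v \<and> v \<le> b \<and> v - u < d \<and> x \<in> {u..v} \<and>
        \<bar>integral {u..v} h - (v - u) * h x\<bar> \<ge> e * (v - u)"
  shows "negligible B"
  unfolding negligible_outer_le
proof (intro allI impI)
  fix \<epsilon> :: real assume \<epsilon>: "0 < \<epsilon>"
  obtain \<gamma> where \<gamma>: "gauge \<gamma>" and hen: "\<And>q. q tagged_partial_division_of cbox a b \<Longrightarrow> \<gamma> fine q \<Longrightarrow>
      (\<Sum>(x,k)\<in>q. norm (measure lborel k *\<^sub>R h x - integral k h)) < e * \<epsilon>"
    using Henstock_lemma[of h a b "e * \<epsilon>"] h e \<epsilon> by (auto simp: cbox_interval)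
  \<comment> \<open>an index is a triple of a tag, a left and a right end point\<close>
  define K where "K = {(x,u,v). x \<in> B \<and> a \<le> u \<and> u < v \<and> v \<le> b \<and> x \<in> {u..v} \<and> {u..v} \<subseteq> \<gamma> x \<and>
        \<bar>integral {u..v} h - (v - u) * h x\<bar> \<ge> e * (v - u)}"
  define I :: "real \<times> real \<times> real \<Rightarrow> real set" where "I = (\<lambda>(x,u,v). {u..v})"
  define cc :: "real \<times> real \<times> real \<Rightarrow> real" where "cc = (\<lambda>(x,u,v). (u + v) / 2)"
  define rr :: "real \<times> real \<times> real \<Rightarrow> real" where "rr = (\<lambda>(x,u,v). (v - u) / 2)"
  have cball_I: "cball (cc i) (rr i) = I i" for i
    by (cases i) (auto simp: cc_def rr_def I_def cball_eq_atLeastAtMost field_simps)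
  have cover: "\<exists>i. i \<in> K \<and> x \<in> cball (cc i) (rr i) \<and> rr i < d" if x: "x \<in> B" and d: "0 < d" for x d
  proof -
    obtain d' where d': "0 < d'" "ball x d' \<subseteq> \<gamma> x"
      using \<gamma> unfolding gauge_def by (meson open_contains_ball)
    obtain u v where uv: "a \<le> u" "u < v" "v \<le> b" "v - u < min d d'" "x \<in> {u..v}"
        "\<bar>integral {u..v} h - (v - u) * h x\<bar> \<ge> e * (v - u)"
      using B[OF x, of "min d d'"] d d' by auto
    have "{u..v} \<subseteq> ball x d'" using uv by (auto simp: dist_real_def)
    then have "(x,u,v) \<in> K" using uv x d' by (auto simp: K_def)
    moreover have "x \<in> cball (cc (x,u,v)) (rr (x,u,v))" unfolding cball_I using uv by (simp add: I_def)
    moreover have "rr (x,u,v) < d" using uv by (simp add: rr_def)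
    ultimately show ?thesis by blast
  qed
  obtain C where C: "countable C" "C \<subseteq> K" "pairwise (\<lambda>i j. disjnt (cball (cc i) (rr i)) (cball (cc j) (rr j))) C"
     "negligible (B - (\<Union>i\<in>C. cball (cc i) (rr i)))"
  proof (rule Vitali_covering_theorem_cballs[of K rr B cc])
    show "0 < rr i" if "i \<in> K" for i using that by (auto simp: K_def rr_def)
  qed (rule cover)
  have C': "pairwise (\<lambda>i j. disjnt (I i) (I j)) C" "negligible (B - (\<Union>i\<in>C. I i))"
    using C by (auto simp: cball_I)
  have fin: "(\<Sum>i\<in>F. measure lebesgue (I i)) \<le> \<epsilon>" if F: "finite F" "F \<subseteq> C" for F
  proof -
    define q where "q = (\<lambda>i. (fst i, I i)) ` F"
    have inj: "inj_on (\<lambda>i. (fst i, I i)) F"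
    proof (rule inj_onI)
      fix i j assume "i \<in> F" "j \<in> F" "(fst i, I i) = (fst j, I j)"
      moreover have "I i \<noteq> {}" using \<open>i \<in> F\<close> F C by (force simp: I_def K_def)
      moreover have "disjnt (I i) (I j)" if "i \<noteq> j"
        using C'(1) F \<open>i \<in> F\<close> \<open>j \<in> F\<close> that by (auto simp: pairwise_def)
      ultimately show "i = j" by (auto simp: disjnt_def)
    qed
    have "q tagged_partial_division_of cbox a b"
      unfolding tagged_partial_division_of_def
    proof (intro conjI allI impI)
      show "finite q" using F by (simp add: q_def)
      fix x k assume "(x, k) \<in> q"
      then obtain u v where uv: "(x,u,v) \<in> F" "k = {u..v}" by (auto simp: q_def I_def)
      then have K: "(x,u,v) \<in> K" using F C by auto
      show "x \<in> k" "k \<subseteq> cbox a b" "\<exists>a b. k = cbox a b"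
        using K uv by (auto simp: K_def cbox_interval)
    next
      fix x1 k1 x2 k2 assume "(x1, k1) \<in> q \<and> (x2, k2) \<in> q \<and> (x1, k1) \<noteq> (x2, k2)" 
      moreover from this obtain i where i: "i \<in> F" "(x1, k1) = (fst i, I i)"
        unfolding q_def by (meson imageE)
      moreover from calculation obtain j where j: "j \<in> F" "(x2, k2) = (fst j, I j)"
        unfolding q_def by (meson imageE)
      ultimately have "i \<noteq> j" "k1 = I i" "k2 = I j" by auto
      then have "k1 \<inter> k2 = {}" using C'(1) F i(1) j(1) by (auto simp: pairwise_def disjnt_def)
      then show "interior k1 \<inter> interior k2 = {}" using interior_subset by blast
    qed
    moreover have "\<gamma> fine q"
      unfolding fine_def
    proof (intro ballI, clarify)
      fix x k assume "(x, k) \<in> q"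
      then obtain i where i: "i \<in> F" "(x, k) = (fst i, I i)" unfolding q_def by (meson imageE)
      then have "i \<in> K" using F C by auto
      moreover fix y assume "y \<in> k"
      ultimately show "y \<in> \<gamma> x" using i(2) by (auto simp: K_def I_def)
    qed
    ultimately have "(\<Sum>(x,k)\<in>q. norm (measure lborel k *\<^sub>R h x - integral k h)) < e * \<epsilon>"
      by (rule hen)
    moreover have "(\<Sum>i\<in>F. e * measure lebesgue (I i)) \<le> (\<Sum>(x,k)\<in>q. norm (measure lborel k *\<^sub>R h x - integral k h))"
      unfolding q_def sum.reindex[OF inj] o_def
    proof (intro sum_mono)
      fix i assume "i \<in> F"
      then have "i \<in> K" using F C by auto
      then show "e * measure lebesgue (I i) \<le> (case (fst i, I i) of (x, k) \<Rightarrow> norm (measure lborel k *\<^sub>R h x - integral k h))"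
        by (auto simp: K_def I_def abs_minus_commute)
    qed
    ultimately have "e * (\<Sum>i\<in>F. measure lebesgue (I i)) < e * \<epsilon>"
      unfolding sum_distrib_left by linarith
    then show ?thesis using e by simp
  qed
  have meas: "(\<Union>i\<in>C. I i) \<in> lmeasurable" "measure lebesgue (\<Union>i\<in>C. I i) \<le> \<epsilon>"
  proof -
    have D: "measure lebesgue (\<Union>(I ` F)) \<le> \<epsilon>" if "finite F" "F \<subseteq> C" for F
      using fin[OF that] measure_UNION_le[of F I lebesgue] that(1) by (force simp: I_def split: prod.splits)
    show "(\<Union>i\<in>C. I i) \<in> lmeasurable"
      by (rule fmeasurable_UN_bound[where B = \<epsilon>]) (use C D in \<open>auto simp: I_def split: prod.splits\<close>)
    show "measure lebesgue (\<Union>i\<in>C. I i) \<le> \<epsilon>"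
      by (rule measure_UN_bound[where B = \<epsilon>]) (use C D in \<open>auto simp: I_def split: prod.splits\<close>)
  qed
  show "\<exists>T. B \<subseteq> T \<and> T \<in> lmeasurable \<and> measure lebesgue T \<le> \<epsilon>"
  proof (intro exI conjI)
    let ?N = "B - (\<Union>i\<in>C. I i)"
    show "B \<subseteq> ?N \<union> (\<Union>i\<in>C. I i)" by blast
    show "?N \<union> (\<Union>i\<in>C. I i) \<in> lmeasurable"
      by (intro fmeasurable.Un negligible_imp_measurable[OF C'(2)] meas(1))
    have "measure lebesgue (?N \<union> (\<Union>i\<in>C. I i)) \<le> measure lebesgue ?N + measure lebesgue (\<Union>i\<in>C. I i)"
      using negligible_imp_measurable[OF C'(2)] by (intro measure_Un_le fmeasurableD meas(1))
    then show "measure lebesgue (?N \<union> (\<Union>i\<in>C. I i)) \<le> \<epsilon>"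
      using meas(2) negligible_imp_measure0[OF C'(2)] by linarith
  qed
qed

text \<open>
  The relation between a function and its derivative that survives if the derivative exists only
  almost everywhere. It is stated by increments, so that it is stable under restriction,
  affine substitution and linear combination.
\<close>
definition primitive_on :: "real \<Rightarrow> real \<Rightarrow> (real \<Rightarrow> real) \<Rightarrow> (real \<Rightarrow> real) \<Rightarrow> bool" where
  "primitive_on a b W w \<longleftrightarrow>
     (\<forall>u v. a \<le> u \<longrightarrow> u \<le> v \<longrightarrow> v \<le> b \<longrightarrow> (w has_integral (W v - W u)) {u..v})"

text \<open>
  Lebesgue's differentiation theorem. The exceptional set is the union over \<open>n\<close> of the null sets where the
  difference quotient fails to be within \<open>1 / Suc n\<close> of \<open>w x\<close>.
\<close>
lemma primitive_on_derivative_AE: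
  assumes W: "primitive_on a b W w" and ab: "a < b"
  shows "AE x in lebesgue_on {a..b}. (W has_vector_derivative w x) (at x within {a..b})"
proof -
  define B where "B e = {x. \<forall>d>0. \<exists>u v. a \<le> u \<and> u < v \<and> v \<le> b \<and> v - u < d \<and> x \<in> {u..v} \<and>
        \<bar>integral {u..v} w - (v - u) * w x\<bar> \<ge> e * (v - u)}" for e :: real
  have hi: "integral {u..v} w = W v - W u" if "a \<le> u" "u \<le> v" "v \<le> b" for u v
    using W that unfolding primitive_on_def by (intro integral_unique) auto
  have "w integrable_on {a..b}"
    using W ab unfolding primitive_on_def integrable_on_def by (meson less_imp_le order_refl)
  then have neg: "negligible (B e)" if "0 < e" for e
    by (rule negligible_large_difference_quotient[of w a b e]) (use that in \<open>auto simp: B_def\<close>)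
  define N where "N = (\<Union>n. B (1 / Suc n))"
  have "negligible N"
    unfolding N_def by (intro negligible_countable_Union) (auto intro: neg)
  moreover have "(W has_vector_derivative w x) (at x within {a..b})" if x: "x \<in> {a..b}" "x \<notin> N" for x
    unfolding has_vector_derivative_def has_derivative_within_alt
  proof (intro conjI allI impI)
    show "bounded_linear (\<lambda>h. h *\<^sub>R w x)" by (rule bounded_linear_scaleR_left)
    fix e :: real assume "0 < e"
    then obtain n where n: "1 / Suc n < e" using nat_approx_posE by blast
    have "x \<notin> B (1 / Suc n)" using x by (auto simp: N_def)
    then obtain d where d: "d > 0" and "\<not> (\<exists>u v. a \<le> u \<and> u < v \<and> v \<le> b \<and> v - u < d \<and> x \<in> {u..v} \<and>
        \<bar>integral {u..v} w - (v - u) * w x\<bar> \<ge> 1 / Suc n * (v - u))"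
      unfolding B_def by blast
    then have dd: "\<bar>integral {u..v} w - (v - u) * w x\<bar> < 1 / Suc n * (v - u)"
      if "a \<le> u" "u < v" "v \<le> b" "v - u < d" "x \<in> {u..v}" for u v
      using that by (meson not_le)
    show "\<exists>d>0. \<forall>y\<in>{a..b}. norm (y - x) < d \<longrightarrow> norm (W y - W x - (y - x) *\<^sub>R w x) \<le> e * norm (y - x)"
    proof (intro exI conjI ballI impI)
      fix y assume y: "y \<in> {a..b}" "norm (y - x) < d"
      \<comment> \<open>one-sided quotients on either side of \<open>x\<close> are treated at once\<close>
      define u where "u = min x y"
      define v where "v = max x y"
      have eq: "norm (W y - W x - (y - x) *\<^sub>R w x) = \<bar>(W v - W u) - (v - u) * w x\<bar>" "norm (y - x) = v - u"
        by (auto simp: u_def v_def min_def max_def algebra_simps)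
      have uv: "a \<le> u" "u \<le> v" "v \<le> b" "x \<in> {u..v}" using x y by (auto simp: u_def v_def)
      show "norm (W y - W x - (y - x) *\<^sub>R w x) \<le> e * norm (y - x)"
      proof (cases "u = v")
        case True then show ?thesis unfolding eq by simp
      next
        case False
        then have "\<bar>(W v - W u) - (v - u) * w x\<bar> < 1 / Suc n * (v - u)"
          using dd[of u v] uv y eq hi[of u v] by auto
        also have "\<dots> \<le> e * (v - u)" using n uv by (intro mult_right_mono) auto
        finally show ?thesis unfolding eq by simp
      qed
    qed fact
  qed
  ultimately show ?thesis
    by (subst AE_restrict_space_iff) (auto simp: negligible_iff_null_sets intro!: AE_I'[of N])
qed

section \<open>Iterated primitives are Sobolev functions\<close>

text \<open>
  On a set of measure at most \<open>d\<close> the integral of \<open>\<bar>w\<bar>\<close> is at most \<open>k * d\<close> plus the integral of the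
  part of \<open>\<bar>w\<bar>\<close> above height \<open>k\<close>. The second term is made small by the choice of \<open>k\<close>, then the
  first by the choice of \<open>d\<close>.
\<close>
lemma primitive_on_abs_continuous:
  assumes W: "primitive_on a b W w" and w: "w absolutely_integrable_on {a..b}"
  shows "abs_continuous_on_Icc a b W"
  unfolding abs_continuous_on_Icc_def
proof (intro allI impI)
  fix e :: real assume e: "0 < e"
  define f where "f x = indicator {a..b} x * w x" for x
  have f: "integrable lebesgue f" using w unfolding f_def set_integrable_def by simp
  have [measurable]: "f \<in> borel_measurable lebesgue" using f by auto
  \<comment> \<open>the part of \<open>\<bar>f\<bar>\<close> above height \<open>k\<close>\<close>
  define t where "t k x = max 0 (\<bar>f x\<bar> - real k)" for k x
  have [measurable]: "t k \<in> borel_measurable lebesgue" for k unfolding t_def by measurable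
  have t: "integrable lebesgue (t k)" for k
    by (rule Bochner_Integration.integrable_bound[OF integrable_norm[OF f]]) (auto simp: t_def)
  have "(\<lambda>k. LINT x|lebesgue. t k x) \<longlonglongrightarrow> (LINT x::real|lebesgue. 0)"
  proof (rule integral_dominated_convergence[where w = "\<lambda>x. \<bar>f x\<bar>"])
    show "AE x in lebesgue. (\<lambda>k. t k x) \<longlonglongrightarrow> 0"
    proof (intro AE_I2 tendsto_eventually)
      fix x
      obtain K :: nat where "\<bar>f x\<bar> \<le> real K" using real_arch_simple by blast
      then show "\<forall>\<^sub>F k in sequentially. t k x = 0"
        by (intro eventually_sequentiallyI[of K]) (auto simp: t_def)
    qed
  qed (use f t in \<open>auto simp: t_def\<close>)
  then have "\<forall>\<^sub>F k in sequentially. (LINT x|lebesgue. t k x) < e / 2"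
    using e by (intro order_tendstoD(2)) auto
  then obtain k where k: "(LINT x|lebesgue. t k x) < e / 2" by (auto simp: eventually_sequentially)
  show "\<exists>d>0. \<forall>(N::nat) u v. (\<forall>i<N. a \<le> u i \<and> u i \<le> v i \<and> v i \<le> b) \<and>
        (\<forall>i<N. \<forall>j<N. i \<noteq> j \<longrightarrow> {u i<..<v i} \<inter> {u j<..<v j} = {}) \<and>
        (\<Sum>i<N. v i - u i) < d \<longrightarrow> (\<Sum>i<N. \<bar>W (v i) - W (u i)\<bar>) < e"
  proof (intro exI[of _ "e / (2 * (real k + 1))"] conjI allI impI)
    show "0 < e / (2 * (real k + 1))" using e by simp
    fix N :: nat and u v :: "nat \<Rightarrow> real"
    assume A: "(\<forall>i<N. a \<le> u i \<and> u i \<le> v i \<and> v i \<le> b) \<and>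
        (\<forall>i<N. \<forall>j<N. i \<noteq> j \<longrightarrow> {u i<..<v i} \<inter> {u j<..<v j} = {}) \<and>
        (\<Sum>i<N. v i - u i) < e / (2 * (real k + 1))"
    then have uv: "\<forall>i<N. a \<le> u i \<and> u i \<le> v i \<and> v i \<le> b"
      and dj: "\<forall>i<N. \<forall>j<N. i \<noteq> j \<longrightarrow> {u i<..<v i} \<inter> {u j<..<v j} = {}"
      and small: "(\<Sum>i<N. v i - u i) < e / (2 * (real k + 1))"
      by blast+
    define I where "I i = {u i<..<v i}" for i
    have tI: "integrable lebesgue (\<lambda>x. indicator (I i) x * t k x)" for i
      using integrable_mult_indicator[OF _ t, of "I i" k] by (simp add: I_def)
    have kI: "integrable lebesgue (\<lambda>x. indicator (I i) x * real k)" for i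
      using lmeasurable_box[of "u i" "v i"] by (simp add: I_def lmeasurable_iff_integrable box_real)
    have est: "\<bar>W (v i) - W (u i)\<bar> \<le> real k * (v i - u i) + (LINT x|lebesgue. indicator (I i) x * t k x)"
      if i: "i < N" for i
    proof -
      have fI: "integrable lebesgue (\<lambda>x. indicator (I i) x * f x)"
        using integrable_mult_indicator[OF _ f, of "I i"] by (simp add: I_def)
      have sub: "x \<in> {a..b}" if "x \<in> I i" for x using that uv i by (force simp: I_def)
      have eqf: "(\<lambda>x. indicator (I i) x * f x) = (\<lambda>x. indicator (I i) x *\<^sub>R w x)"
        using sub by (auto simp: f_def fun_eq_iff indicator_def)
      then have "set_integrable lebesgue (I i) w" using fI by (simp add: set_integrable_def)
      then have "(w has_integral (LINT x|lebesgue. indicator (I i) x * f x)) (I i)"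
        using has_integral_set_lebesgue[of "I i" w] unfolding set_lebesgue_integral_def eqf by simp
      moreover have "(w has_integral (W (v i) - W (u i))) (I i)"
        using W uv i unfolding primitive_on_def I_def has_integral_Icc_iff_Ioo[symmetric] by auto
      ultimately have "W (v i) - W (u i) = (LINT x|lebesgue. indicator (I i) x * f x)"
        by (rule has_integral_unique[symmetric])
      also have "\<bar>\<dots>\<bar> \<le> (LINT x|lebesgue. \<bar>indicator (I i) x * f x\<bar>)" by (rule integral_abs_bound)
      also have "\<dots> \<le> (LINT x|lebesgue. indicator (I i) x * real k + indicator (I i) x * t k x)"
        using fI tI kI by (intro integral_mono) (auto simp: t_def indicator_def)
      also have "\<dots> = (LINT x|lebesgue. indicator (I i) x * real k) + (LINT x|lebesgue. indicator (I i) x * t k x)"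
        using tI kI by simp
      also have "(LINT x|lebesgue. indicator (I i) x * real k) = real k * (v i - u i)"
        using uv i by (simp add: I_def)
      finally show ?thesis .
    qed
    have "(\<Sum>i<N. \<bar>W (v i) - W (u i)\<bar>) \<le>
       (\<Sum>i<N. real k * (v i - u i) + (LINT x|lebesgue. indicator (I i) x * t k x))"
      using est by (intro sum_mono) auto
    also have "\<dots> = real k * (\<Sum>i<N. v i - u i) + (LINT x|lebesgue. (\<Sum>i<N. indicator (I i) x * t k x))"
      by (simp only: sum.distrib sum_distrib_left[symmetric] Bochner_Integration.integral_sum[OF tI])
    also have "(LINT x|lebesgue. (\<Sum>i<N. indicator (I i) x * t k x)) \<le> (LINT x|lebesgue. t k x)"
    proof (rule integral_mono)
      fix x
      have "(\<Sum>i<N. indicator (I i) x) = (indicator (\<Union>i<N. I i) x :: real)"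
        using dj by (subst indicator_UN_disjoint) (auto simp: disjoint_family_on_def I_def)
      then have "(\<Sum>i<N. indicator (I i) x) \<le> (1::real)" by (simp add: indicator_def)
      then have "(\<Sum>i<N. indicator (I i) x) * t k x \<le> 1 * t k x" by (intro mult_right_mono) (auto simp: t_def)
      then show "(\<Sum>i<N. indicator (I i) x * t k x) \<le> t k x" by (simp add: sum_distrib_right)
    qed (intro Bochner_Integration.integrable_sum tI t)+
    also have "real k * (\<Sum>i<N. v i - u i) \<le> real k * (e / (2 * (real k + 1)))"
      using small by (intro mult_left_mono) auto
    also have "\<dots> \<le> e / 2" using e by (simp add: field_simps)
    finally show "(\<Sum>i<N. \<bar>W (v i) - W (u i)\<bar>) < e" using k by simp
  qed
qed

text \<open>
  On a bounded interval \<open>L\<^sup>p\<close> is contained in \<open>L\<^sup>1\<close>, because \<open>\<bar>y\<bar> \<le> 1 + \<bar>y\<bar> powr p\<close>.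
\<close>
lemma Lp_space_imp_absolutely_integrable:
  assumes "w \<in> Lp_space p a b" "1 \<le> p"
  shows "w absolutely_integrable_on {a..b}"
proof -
  have w: "w \<in> borel_measurable (lebesgue_on {a..b})" "integrable (lebesgue_on {a..b}) (\<lambda>x. \<bar>w x\<bar> powr p)"
    using assms by (auto simp: Lp_space_def)
  have "integrable (lebesgue_on {a..b}) w"
  proof (rule Bochner_Integration.integrable_bound)
    show "integrable (lebesgue_on {a..b}) (\<lambda>x. 1 + \<bar>w x\<bar> powr p)"
      using w(2) by (intro Bochner_Integration.integrable_add integrable_const)
        (auto simp: finite_measure_lebesgue_on)
    have "\<bar>y\<bar> \<le> 1 + \<bar>y\<bar> powr p" for y :: real
    proof (cases "\<bar>y\<bar> \<le> 1")
      case False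
      then have "\<bar>y\<bar> powr 1 \<le> \<bar>y\<bar> powr p" using assms(2) by (intro powr_mono) auto
      then show ?thesis using False by simp
    qed (simp add: add_increasing2)
    then show "AE x in lebesgue_on {a..b}. norm (w x) \<le> norm (1 + \<bar>w x\<bar> powr p)"
      by (intro AE_I2) (simp add: abs_of_nonneg add_nonneg_nonneg)
  qed (use w in auto)
  then show ?thesis
    by (simp add: set_integrable_def integrable_restrict_space)
qed

lemma borel_measurable_lebesgue_on_AE:
  fixes f g :: "real \<Rightarrow> real"
  assumes f: "f \<in> borel_measurable (lebesgue_on S)" and S: "S \<in> sets lebesgue"
    and AE: "AE x in lebesgue_on S. f x = g x"
  shows "g \<in> borel_measurable (lebesgue_on S)"
proof -
  have "AE x in lebesgue. (if x \<in> S then f x else 0) = (if x \<in> S then g x else 0)"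
    using AE S by (subst (asm) AE_restrict_space_iff) auto
  then have "(\<lambda>x. if x \<in> S then g x else 0) \<in> borel_measurable lebesgue"
    by (rule borel_measurable_AE[OF borel_measurable_if_I[OF f S]])
  then show ?thesis by (rule borel_measurable_if_D)
qed

text \<open>
  Below order \<open>s\<close> the primitives have continuous integrands, and the fundamental theorem of calculus
  gives the derivatives everywhere; the derivative of order \<open>s\<close> is found almost everywhere by Lebesgue's
  theorem. Only the values of \<open>f\<close> on \<open>{a..b}\<close> enter, since all derivatives are taken within
  this interval.
\<close>
lemma Sobolev_space_chain:
  fixes G :: "nat \<Rightarrow> real \<Rightarrow> real"
  assumes ab: "a < b" and s: "1 \<le> s" and p: "1 \<le> p"
    and prim: "\<And>j. j < s \<Longrightarrow> primitive_on a b (G j) (G (Suc j))"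
    and cont: "\<And>j. j < s \<Longrightarrow> continuous_on {a..b} (G j)"
    and Lp: "G s \<in> Lp_space p a b"
    and f: "\<And>x. x \<in> {a..b} \<Longrightarrow> f x = G 0 x"
  shows "f \<in> Sobolev_space s p a b"
    and "AE x in lebesgue_on {a..b}. iter_deriv a b s f x = G s x"
    and "Lp_norm p a b (iter_deriv a b s f) = Lp_norm p a b (G s)"
proof -
  have Suc_eq: "iter_deriv a b (Suc j) f x = vector_derivative (iter_deriv a b j f) (at x within {a..b})" for j x
    by (simp add: iter_deriv_def)
  have int: "G j y = integral {a..y} (G (Suc j)) + G j a" if "y \<in> {a..b}" "j < s" for y j
    using prim[OF that(2)] that(1) integral_unique[of "G (Suc j)" "G j y - G j a" "{a..y}"]
    by (simp add: primitive_on_def)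
  have step: "(G j has_vector_derivative G (Suc j) x) (at x within {a..b})"
    if j: "Suc j < s" and x: "x \<in> {a..b}" for j x
  proof -
    have "((\<lambda>y. integral {a..y} (G (Suc j)) + G j a) has_vector_derivative G (Suc j) x) (at x within {a..b})"
      using integral_has_vector_derivative[OF cont[OF j] x] by (simp add: has_vector_derivative_add_const)
    then show ?thesis
      by (rule has_vector_derivative_transform[OF x, rotated]) (erule int, use j in simp)
  qed
  have eq: "iter_deriv a b j f x = G j x" if "j < s" "x \<in> {a..b}" for j x
    using that
  proof (induction j arbitrary: x)
    case 0
    then show ?case using f by (simp add: iter_deriv_def)
  next
    case (Suc j)
    have "(iter_deriv a b j f has_vector_derivative G (Suc j) x) (at x within {a..b})"
      by (rule has_vector_derivative_transform[OF Suc.prems(2) _ step[OF Suc.prems]])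
        (use Suc in auto)
    then show ?case
      unfolding Suc_eq using ab Suc.prems(2) by (intro vector_derivative_within_closed_interval)
  qed
  obtain q where q: "s = Suc q" using s by (cases s) auto
  have "AE x in lebesgue_on {a..b}. (G q has_vector_derivative G s x) (at x within {a..b})"
    using primitive_on_derivative_AE[OF prim[of q] ab] q by simp
  then show AE: "AE x in lebesgue_on {a..b}. iter_deriv a b s f x = G s x"
    using AE_space
  proof eventually_elim
    case (elim x)
    then have x: "x \<in> {a..b}" by simp
    have "(iter_deriv a b q f has_vector_derivative G s x) (at x within {a..b})"
      by (rule has_vector_derivative_transform[OF x _ elim(1)]) (use eq q in auto)
    then show ?case
      unfolding q Suc_eq using ab x by (intro vector_derivative_within_closed_interval)
  qed
  obtain C where C: "Lp_le p (lebesgue_on {a..b}) (G s) C"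
    using Lp Lp_le_iff_Lp_space[OF p] by blast
  have AE': "AE x in lebesgue_on {a..b}. G s x = iter_deriv a b s f x"
    using AE by eventually_elim simp
  have meas: "iter_deriv a b s f \<in> borel_measurable (lebesgue_on {a..b})"
    by (rule borel_measurable_lebesgue_on_AE[OF _ _ AE']) (use Lp in \<open>auto simp: Lp_space_def\<close>)
  have "Lp_le p (lebesgue_on {a..b}) (iter_deriv a b s f) C"
    by (rule Lp_le_cong_AE[OF C AE' meas])
  then have L: "iter_deriv a b s f \<in> Lp_space p a b"
    using Lp_le_iff_Lp_space[OF p] by blast
  have abs: "G (Suc j) absolutely_integrable_on {a..b}" if "j < s" for j
  proof (cases "Suc j < s")
    case True then show ?thesis by (intro absolutely_integrable_continuous_real cont)
  next
    case False then show ?thesis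
      using that Lp_space_imp_absolutely_integrable[OF Lp p] by (metis Suc_lessI)
  qed
  have ac: "abs_continuous_on_Icc a b (iter_deriv a b j f)" if "j < s" for j
  proof -
    have "primitive_on a b (iter_deriv a b j f) (G (Suc j))"
      using prim[OF that] eq[OF that] by (auto simp: primitive_on_def)
    then show ?thesis using abs[OF that] by (rule primitive_on_abs_continuous)
  qed
  have "iter_deriv a b j f differentiable_on {a..b}" if "Suc j < s" for j
    unfolding differentiable_on_def
  proof
    fix x assume x: "x \<in> {a..b}"
    have "(iter_deriv a b j f has_vector_derivative G (Suc j) x) (at x within {a..b})"
      by (rule has_vector_derivative_transform[OF x _ step[OF that x]]) (use eq that in auto)
    then show "iter_deriv a b j f differentiable (at x within {a..b})"
      by (rule differentiableI_vector)
  qed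
  then show "f \<in> Sobolev_space s p a b"
    using ac L by (simp add: Sobolev_space_def)
  have "(LINT x|lebesgue_on {a..b}. \<bar>iter_deriv a b s f x\<bar> powr p) = (LINT x|lebesgue_on {a..b}. \<bar>G s x\<bar> powr p)"
    using AE meas Lp by (intro integral_cong_AE) (auto simp: Lp_space_def)
  then show "Lp_norm p a b (iter_deriv a b s f) = Lp_norm p a b (G s)"
    by (simp add: Lp_norm_def)
qed

section \<open>Sliding integrals and difference quotients\<close>

lemma primitive_on_continuous:
  assumes "primitive_on a b W w"
  shows "continuous_on {a..b} W"
proof (cases "a \<le> b")
  case True
  have "w integrable_on {a..b}"
    using assms True unfolding primitive_on_def integrable_on_def by (meson order_refl)
  then have "continuous_on {a..b} (\<lambda>x. integral {a..x} w + W a)"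
    by (intro continuous_intros indefinite_integral_continuous_1)
  then show ?thesis
  proof (rule continuous_on_eq)
    show "integral {a..x} w + W a = W x" if "x \<in> {a..b}" for x
      using assms that integral_unique[of w "W x - W a" "{a..x}"] by (simp add: primitive_on_def)
  qed
qed auto

lemma has_integral_affine_real:
  fixes w :: "real \<Rightarrow> real"
  assumes w: "(w has_integral I) {y + d * c..y + d * e}" and d: "0 < d"
  shows "((\<lambda>t. w (y + d * t)) has_integral I / d) {c..e}"
proof -
  have "((\<lambda>x. w (d *\<^sub>R x + y)) has_integral I /\<^sub>R d ^ DIM(real))
     (cbox ((y + d * c - y) /\<^sub>R d) ((y + d * e - y) /\<^sub>R d))"
    using w d by (intro has_integral_affinity') (simp_all add: cbox_interval)
  moreover have "(y + d * c - y) /\<^sub>R d = c" "(y + d * e - y) /\<^sub>R d = e"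
    using d by simp_all
  ultimately have "((\<lambda>x. w (d *\<^sub>R x + y)) has_integral I /\<^sub>R d ^ DIM(real)) (cbox c e)"
    by (simp only:)
  then show ?thesis
    by (simp add: cbox_interval add.commute[of y] divide_inverse mult.commute[of I])
qed

lemma primitive_on_affine:
  assumes W: "primitive_on (\<alpha> + l * a) (\<alpha> + l * b) W w" and l: "0 \<le> l"
  shows "primitive_on a b (\<lambda>x. W (\<alpha> + l * x)) (\<lambda>x. l * w (\<alpha> + l * x))"
  unfolding primitive_on_def
proof (intro allI impI)
  fix u v assume uv: "a \<le> u" "u \<le> v" "v \<le> b"
  show "((\<lambda>x. l * w (\<alpha> + l * x)) has_integral W (\<alpha> + l * v) - W (\<alpha> + l * u)) {u..v}"
  proof (cases "l = 0")
    case False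
    then have l: "0 < l" using l by simp
    have "(w has_integral W (\<alpha> + l * v) - W (\<alpha> + l * u)) {\<alpha> + l * u..\<alpha> + l * v}"
      using W uv l unfolding primitive_on_def by simp
    from has_integral_mult_right[OF has_integral_affine_real[OF this l], of l] l
    show ?thesis by simp
  qed simp
qed

lemma primitive_on_cmult:
  "primitive_on a b W w \<Longrightarrow> primitive_on a b (\<lambda>x. c * W x) (\<lambda>x. c * w x)"
  unfolding primitive_on_def by (auto simp: right_diff_distrib[symmetric] intro!: has_integral_mult_right)

lemma primitive_on_sum:
  assumes "finite A" "\<And>i. i \<in> A \<Longrightarrow> primitive_on a b (W i) (w i)"
  shows "primitive_on a b (\<lambda>x. \<Sum>i\<in>A. W i x) (\<lambda>x. \<Sum>i\<in>A. w i x)"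
  using assms unfolding primitive_on_def by (auto simp: sum_subtractf[symmetric] intro!: has_integral_sum)

text \<open>
  This property on the whole line is preserved by affine substitutions and sliding integrals, so that
  these can be iterated without keeping track of domains.
\<close>
definition locally_integrable :: "(real \<Rightarrow> real) \<Rightarrow> bool" where
  "locally_integrable u \<longleftrightarrow> (\<forall>c e. u absolutely_integrable_on {c..e})"

lemma locally_integrableD: "locally_integrable u \<Longrightarrow> u absolutely_integrable_on {c..e}"
  by (simp add: locally_integrable_def)

lemma locally_integrable_continuous: "continuous_on UNIV u \<Longrightarrow> locally_integrable u"
  unfolding locally_integrable_def
  by (blast intro: absolutely_integrable_continuous_real continuous_on_subset)

lemma locally_integrable_affine:
  assumes u: "locally_integrable u" and d: "0 < d"
  shows "locally_integrable (\<lambda>t. u (y + d * t))"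
  unfolding locally_integrable_def absolutely_integrable_on_def
proof (intro allI conjI)
  fix c e
  have aff: "(\<lambda>t. v (y + d * t)) integrable_on {c..e}"
    if v: "v integrable_on {y + d * c..y + d * e}" for v :: "real \<Rightarrow> real"
  proof -
    obtain i where "(v has_integral i) {y + d * c..y + d * e}"
      using v by (auto simp: integrable_on_def)
    from has_integral_affine_real[OF this d] show ?thesis by (auto simp: integrable_on_def)
  qed
  have "u absolutely_integrable_on {y + d * c..y + d * e}" using u by (rule locally_integrableD)
  then show "(\<lambda>t. u (y + d * t)) integrable_on {c..e}" "(\<lambda>t. norm (u (y + d * t))) integrable_on {c..e}"
    using aff[of u] aff[of "\<lambda>x. norm (u x)"] by (auto simp: absolutely_integrable_on_def)
qed

lemma locally_integrable_shift: "locally_integrable u \<Longrightarrow> locally_integrable (\<lambda>t. u (t + h))"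
  using locally_integrable_affine[of u 1 h] by (simp add: add.commute)

lemma locally_integrable_cmult: "locally_integrable u \<Longrightarrow> locally_integrable (\<lambda>t. c * u t)"
  unfolding locally_integrable_def by simp

lemma locally_integrable_add:
  "locally_integrable u \<Longrightarrow> locally_integrable v \<Longrightarrow> locally_integrable (\<lambda>t. u t + v t)"
  unfolding locally_integrable_def by (auto intro: set_integral_add)

lemma locally_integrable_diff:
  "locally_integrable u \<Longrightarrow> locally_integrable v \<Longrightarrow> locally_integrable (\<lambda>t. u t - v t)"
  unfolding locally_integrable_def by (auto intro: set_integral_diff)

lemma locally_integrable_const: "locally_integrable (\<lambda>t. c)"
  by (intro locally_integrable_continuous continuous_intros)

lemma locally_integrable_sum:
  "finite A \<Longrightarrow> (\<And>i. i \<in> A \<Longrightarrow> locally_integrable (u i)) \<Longrightarrow> locally_integrable (\<lambda>t. \<Sum>i\<in>A. u i t)"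
  by (induction A rule: finite_induct) (auto intro: locally_integrable_add locally_integrable_const)

text \<open>
  The oriented integral from \<open>0\<close> to \<open>x\<close>; one of the two terms vanishes.
\<close>
definition antideriv :: "(real \<Rightarrow> real) \<Rightarrow> real \<Rightarrow> real" where
  "antideriv u x = integral {0..x} u - integral {x..0} u"

lemma antideriv_primitive_on:
  assumes "locally_integrable u"
  shows "primitive_on a b (antideriv u) u"
  unfolding primitive_on_def
proof (intro allI impI)
  fix x y :: real assume xy: "x \<le> y"
  have i: "u integrable_on {c..e}" for c e
    using locally_integrableD[OF assms] absolutely_integrable_on_def by blast
  have z: "integral {c..e} u = 0" if "e \<le> c" for c e
    using that by (cases "e = c") auto
  have "integral {x..y} u = antideriv u y - antideriv u x"
  proof -
    consider "0 \<le> x" | "x < 0" "0 \<le> y" | "y < 0" by linarith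
    then show ?thesis
    proof cases
      case 1
      then show ?thesis using Henstock_Kurzweil_Integration.integral_combine[of 0 x y u] xy i z
        unfolding antideriv_def by force
    next
      case 2
      then show ?thesis using Henstock_Kurzweil_Integration.integral_combine[of x 0 y u] xy i z
        unfolding antideriv_def by force
    next
      case 3
      then show ?thesis using Henstock_Kurzweil_Integration.integral_combine[of x y 0 u] xy i z
        unfolding antideriv_def by force
    qed
  qed
  then show "(u has_integral antideriv u y - antideriv u x) {x..y}"
    using integrable_integral[OF i[of x y]] by simp
qed

lemma antideriv_continuous:
  assumes "locally_integrable u"
  shows "continuous_on UNIV (antideriv u)"
proof (rule continuous_at_imp_continuous_on, intro ballI)
  fix x
  have "continuous_on {x - 1..x + 1} (antideriv u)"
    by (rule primitive_on_continuous[OF antideriv_primitive_on[OF assms]])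
  then show "isCont (antideriv u) x" by (rule continuous_on_interior) simp
qed

text \<open>
  Up to the factor \<open>\<delta>\<close>, the mean of \<open>u\<close> over \<open>{y..y + d * \<delta>}\<close>. A Steklov average of order \<open>r\<close> is composed
  of \<open>r\<close>-th iterates of these operators.
\<close>
definition sliding_int :: "real \<Rightarrow> real \<Rightarrow> (real \<Rightarrow> real) \<Rightarrow> real \<Rightarrow> real" where
  "sliding_int \<delta> d u y = (LINT t:{0..\<delta>}|lebesgue. u (y + d * t))"

text \<open>
  The derivative of \<open>sliding_int \<delta> d u\<close> for continuous \<open>u\<close>, see \<open>sliding_int_primitive_on\<close>.
\<close>
definition dquot :: "real \<Rightarrow> real \<Rightarrow> (real \<Rightarrow> real) \<Rightarrow> real \<Rightarrow> real" where
  "dquot \<delta> d u y = (u (y + d * \<delta>) - u y) / d"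

lemma sliding_int_eq_antideriv:
  assumes u: "locally_integrable u" and d: "0 < d" and \<delta>: "0 \<le> \<delta>"
  shows "sliding_int \<delta> d u y = (antideriv u (y + d * \<delta>) - antideriv u y) / d"
proof -
  have "sliding_int \<delta> d u y = integral {0..\<delta>} (\<lambda>t. u (y + d * t))"
    unfolding sliding_int_def
    by (rule set_lebesgue_integral_eq_integral[OF locally_integrableD[OF locally_integrable_affine[OF u d]]])
  moreover have "(u has_integral (antideriv u (y + d * \<delta>) - antideriv u y)) {y + d * 0..y + d * \<delta>}"
    using antideriv_primitive_on[OF u, of y "y + d * \<delta>"] d \<delta> by (simp add: primitive_on_def)
  from has_integral_affine_real[OF this d]
  have "((\<lambda>t. u (y + d * t)) has_integral ((antideriv u (y + d * \<delta>) - antideriv u y) / d)) {0..\<delta>}" .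
  ultimately show ?thesis by (simp add: integral_unique)
qed

lemma sliding_int_continuous:
  assumes "locally_integrable u" "0 < d" "0 \<le> \<delta>"
  shows "continuous_on UNIV (sliding_int \<delta> d u)"
proof -
  have "continuous_on UNIV (\<lambda>y. (antideriv u (y + d * \<delta>) - antideriv u y) / d)"
    using assms(2)
    by (intro continuous_intros continuous_on_compose2[OF antideriv_continuous[OF assms(1)]]) auto
  then show ?thesis by (rule continuous_on_eq) (simp add: sliding_int_eq_antideriv[OF assms])
qed

text \<open>
  The sliding integral is a difference of two values of an antiderivative \<open>U\<close>, so its increments are
  differences of increments of \<open>U\<close>.
\<close>
lemma sliding_int_primitive_on:
  assumes u: "locally_integrable u" and d: "0 < d" and \<delta>: "0 \<le> \<delta>"
  shows "primitive_on a b (sliding_int \<delta> d u) (dquot \<delta> d u)"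
  unfolding primitive_on_def
proof (intro allI impI)
  fix x y :: real assume xy: "x \<le> y"
  have 1: "primitive_on c e (antideriv u) u" for c e by (rule antideriv_primitive_on[OF u])
  have 2: "primitive_on c e (\<lambda>x. antideriv u (d * \<delta> + 1 * x)) (\<lambda>x. 1 * u (d * \<delta> + 1 * x))" for c e
    by (rule primitive_on_affine[OF 1]) simp
  have "((\<lambda>x. 1 / d * (u (d * \<delta> + 1 * x) - u x)) has_integral
     1 / d * ((antideriv u (d * \<delta> + 1 * y) - antideriv u (d * \<delta> + 1 * x)) - (antideriv u y - antideriv u x))) {x..y}"
    using 1[of x y] 2[of x y] xy unfolding primitive_on_def
    by (intro has_integral_mult_right has_integral_diff) auto
  then show "(dquot \<delta> d u has_integral sliding_int \<delta> d u y - sliding_int \<delta> d u x) {x..y}"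
    unfolding sliding_int_eq_antideriv[OF assms] dquot_def
    by (simp add: diff_divide_distrib algebra_simps)
qed

lemma locally_integrable_sliding_int:
  "locally_integrable u \<Longrightarrow> 0 < d \<Longrightarrow> 0 \<le> \<delta> \<Longrightarrow> locally_integrable (sliding_int \<delta> d u)"
  by (rule locally_integrable_continuous[OF sliding_int_continuous])

lemma locally_integrable_dquot:
  "locally_integrable u \<Longrightarrow> locally_integrable (dquot \<delta> d u)"
  using locally_integrable_cmult[OF locally_integrable_diff[OF locally_integrable_shift[of u "d * \<delta>"]], of u "1 / d"]
  unfolding dquot_def by simp

lemma locally_integrable_sliding_int_pow:
  "locally_integrable u \<Longrightarrow> 0 < d \<Longrightarrow> 0 \<le> \<delta> \<Longrightarrow> locally_integrable ((sliding_int \<delta> d ^^ k) u)"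
  by (induction k) (auto intro: locally_integrable_sliding_int)

lemma locally_integrable_dquot_pow:
  "locally_integrable u \<Longrightarrow> locally_integrable ((dquot \<delta> d ^^ k) u)"
  by (induction k) (auto intro: locally_integrable_dquot)

lemma sliding_int_dquot:
  assumes u: "locally_integrable u" and d: "0 < d" and \<delta>: "0 \<le> \<delta>"
  shows "sliding_int \<delta> d (dquot \<delta> d u) = dquot \<delta> d (sliding_int \<delta> d u)"
proof
  fix y
  have i: "set_integrable lebesgue {0..\<delta>} (\<lambda>t. u (z + d * t))" for z
    by (rule locally_integrableD[OF locally_integrable_affine[OF u d]])
  have "sliding_int \<delta> d (dquot \<delta> d u) y = (LINT t:{0..\<delta>}|lebesgue. (u ((y + d * \<delta>) + d * t) - u (y + d * t)) / d)"
    unfolding sliding_int_def dquot_def by (simp add: algebra_simps)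
  also have "\<dots> = (LINT t:{0..\<delta>}|lebesgue. u ((y + d * \<delta>) + d * t) - u (y + d * t)) / d"
    by simp
  also have "\<dots> = dquot \<delta> d (sliding_int \<delta> d u) y"
    unfolding dquot_def sliding_int_def by (subst set_integral_diff(2)[OF i i]) simp
  finally show "sliding_int \<delta> d (dquot \<delta> d u) y = dquot \<delta> d (sliding_int \<delta> d u) y" .
qed

lemma sliding_int_pow_dquot:
  assumes "locally_integrable u" "0 < d" "0 \<le> \<delta>"
  shows "(sliding_int \<delta> d ^^ k) (dquot \<delta> d u) = dquot \<delta> d ((sliding_int \<delta> d ^^ k) u)"
  by (induction k) (simp_all add: sliding_int_dquot locally_integrable_sliding_int_pow assms)

lemma fwd_diff_0: "fwd_diff 0 h f x = f x"
  by (simp add: fwd_diff_def)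

lemma fwd_diff_Suc: "fwd_diff (Suc s) h f x = fwd_diff s h f (x + h) - fwd_diff s h f x"
proof -
  let ?t = "\<lambda>k. f (x + real k * h)"
  have "fwd_diff (Suc s) h f x = (-1) ^ Suc s * f x + (\<Sum>k=0..s. real (Suc s choose Suc k) * (-1) ^ (s - k) * ?t (Suc k))"
    unfolding fwd_diff_def by (subst sum.atLeast0_atMost_Suc_shift) simp
  also have "(\<Sum>k=0..s. real (Suc s choose Suc k) * (-1) ^ (s - k) * ?t (Suc k)) =
     (\<Sum>k=0..s. real (s choose k) * (-1) ^ (s - k) * ?t (Suc k)) +
     (\<Sum>k=0..s. real (s choose Suc k) * (-1) ^ (s - k) * ?t (Suc k))"
    by (simp add: sum.distrib[symmetric] algebra_simps)
  also have "(\<Sum>k=0..s. real (s choose k) * (-1) ^ (s - k) * ?t (Suc k)) = fwd_diff s h f (x + h)"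
    by (simp add: fwd_diff_def algebra_simps)
  also have "(\<Sum>k=0..s. real (s choose Suc k) * (-1) ^ (s - k) * ?t (Suc k)) =
      (-1) ^ s * f x - fwd_diff s h f x"
  proof -
    have "fwd_diff s h f x = (\<Sum>k=0..Suc s. real (s choose k) * (-1) ^ (s - k) * ?t k)"
      unfolding fwd_diff_def by simp
    also have "\<dots> = (-1) ^ s * f x + (\<Sum>k=0..s. real (s choose Suc k) * (-1) ^ (s - Suc k) * ?t (Suc k))"
      by (subst sum.atLeast0_atMost_Suc_shift) simp
    also have "(\<Sum>k=0..s. real (s choose Suc k) * (-1) ^ (s - Suc k) * ?t (Suc k)) =
        (\<Sum>k=0..s. - (real (s choose Suc k) * (-1) ^ (s - k) * ?t (Suc k)))"
    proof (rule sum.cong[OF refl])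
      fix k assume "k \<in> {0..s}"
      show "real (s choose Suc k) * (-1) ^ (s - Suc k) * ?t (Suc k) = - (real (s choose Suc k) * (-1) ^ (s - k) * ?t (Suc k))"
      proof (cases "k < s")
        case True
        then have "s - k = Suc (s - Suc k)" by simp
        then show ?thesis by simp
      qed simp
    qed
    finally show ?thesis by (simp add: sum_negf)
  qed
  finally show ?thesis by simp
qed

lemma dquot_pow:
  assumes "0 < d"
  shows "(dquot \<delta> d ^^ s) u y = fwd_diff s (d * \<delta>) u y / d ^ s"
  by (induction s arbitrary: y) (use assms in \<open>simp_all add: fwd_diff_0 fwd_diff_Suc dquot_def field_simps\<close>)

lemma fwd_diff_uminus_step:
  "fwd_diff s (- h) f x = (-1) ^ s * fwd_diff s h f (x - real s * h)"
  by (induction s arbitrary: x) (simp_all add: fwd_diff_0 fwd_diff_Suc algebra_simps)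

text \<open>
  Each integration of the iterated integral applies a sliding integral to every summand. The inner
  integrals are locally integrable functions of the outer variable, so that the sum may be taken
  out of the integral at every stage.
\<close>
lemma iter_integral_sliding_int:
  assumes "finite A" "0 \<le> \<delta>" "\<And>m. m \<in> A \<Longrightarrow> 0 < d m" "\<And>m. m \<in> A \<Longrightarrow> locally_integrable (u m)"
  shows "iter_integral \<delta> r (\<lambda>ts. \<Sum>m\<in>A. c m * u m (z m + d m * sum_list ts)) =
    (\<Sum>m\<in>A. c m * (sliding_int \<delta> (d m) ^^ r) (u m) (z m))"
proof (induction r arbitrary: z)
  case (Suc r)
  have "iter_integral \<delta> (Suc r) (\<lambda>ts. \<Sum>m\<in>A. c m * u m (z m + d m * sum_list ts)) =
     (LINT t:{0..\<delta>}|lebesgue. iter_integral \<delta> r (\<lambda>ts. \<Sum>m\<in>A. c m * u m ((z m + d m * t) + d m * sum_list ts)))"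
    by (simp add: algebra_simps)
  also have "\<dots> = (LINT t:{0..\<delta>}|lebesgue. (\<Sum>m\<in>A. c m * (sliding_int \<delta> (d m) ^^ r) (u m) (z m + d m * t)))"
    by (simp only: Suc.IH)
  also have "\<dots> = (\<Sum>m\<in>A. LINT t:{0..\<delta>}|lebesgue. c m * (sliding_int \<delta> (d m) ^^ r) (u m) (z m + d m * t))"
  proof -
    have "set_integrable lebesgue {0..\<delta>} (\<lambda>t. c m * (sliding_int \<delta> (d m) ^^ r) (u m) (z m + d m * t))" if "m \<in> A" for m
      using assms(3,4)[OF that] \<open>0 \<le> \<delta>\<close>
      by (intro locally_integrableD locally_integrable_cmult locally_integrable_affine locally_integrable_sliding_int_pow)
    then show ?thesis
      unfolding set_lebesgue_integral_def set_integrable_def scaleR_sum_right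
      by (rule Bochner_Integration.integral_sum)
  qed
  also have "\<dots> = (\<Sum>m\<in>A. c m * (sliding_int \<delta> (d m) ^^ Suc r) (u m) (z m))"
    by (simp add: sliding_int_def)
  finally show ?case .
qed simp

lemma abs_sliding_int_le:
  assumes u: "locally_integrable u" and d: "0 < d" and \<delta>: "0 \<le> \<delta>"
    and B: "\<And>t. t \<in> {0..\<delta>} \<Longrightarrow> \<bar>u (y + d * t)\<bar> \<le> B"
  shows "\<bar>sliding_int \<delta> d u y\<bar> \<le> \<delta> * B"
proof -
  have i: "set_integrable lebesgue {0..\<delta>} (\<lambda>t. u (y + d * t))"
    by (rule locally_integrableD[OF locally_integrable_affine[OF u d]])
  have "\<bar>sliding_int \<delta> d u y\<bar> \<le> (LINT t:{0..\<delta>}|lebesgue. \<bar>u (y + d * t)\<bar>)"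
    unfolding sliding_int_def using set_integral_norm_bound[OF i] by simp
  also have "\<dots> \<le> (LINT t:{0..\<delta>}|lebesgue. B)"
    using i B by (intro set_integral_mono set_integrable_abs locally_integrableD[OF locally_integrable_const]) auto
  also have "\<dots> = \<delta> * B" using \<delta> by (simp add: set_lebesgue_integral_def)
  finally show ?thesis .
qed

lemma locally_integrable_abs: "locally_integrable u \<Longrightarrow> locally_integrable (\<lambda>x. \<bar>u x\<bar>)"
  unfolding locally_integrable_def by (auto intro: set_integrable_abs)

lemma abs_sliding_int_le_integral:
  assumes u: "locally_integrable u" and d: "0 < d" and \<delta>: "0 \<le> \<delta>"
  shows "\<bar>sliding_int \<delta> d u y\<bar> \<le> 1 / d * integral {y..y + d * \<delta>} (\<lambda>t. \<bar>u t\<bar>)"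
proof -
  have i: "set_integrable lebesgue {0..\<delta>} (\<lambda>t. u (y + d * t))"
    by (rule locally_integrableD[OF locally_integrable_affine[OF u d]])
  have "\<bar>sliding_int \<delta> d u y\<bar> \<le> sliding_int \<delta> d (\<lambda>x. \<bar>u x\<bar>) y"
    unfolding sliding_int_def using set_integral_norm_bound[OF i] by simp
  also have "\<dots> = 1 / d * integral {y..y + d * \<delta>} (\<lambda>t. \<bar>u t\<bar>)"
  proof -
    have "((\<lambda>t. \<bar>u t\<bar>) has_integral antideriv (\<lambda>t. \<bar>u t\<bar>) (y + d * \<delta>) - antideriv (\<lambda>t. \<bar>u t\<bar>) y) {y..y + d * \<delta>}"
      using antideriv_primitive_on[OF locally_integrable_abs[OF u], of y "y + d * \<delta>"] d \<delta>
      by (simp add: primitive_on_def)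
    then show ?thesis
      unfolding sliding_int_eq_antideriv[OF locally_integrable_abs[OF u] d \<delta>] by (simp add: integral_unique)
  qed
  finally show ?thesis .
qed

text \<open>
  The innermost integration is bounded by the integral of \<open>\<bar>u\<bar>\<close> over the whole range of arguments
  that occur, and the remaining \<open>k\<close> integrations contribute a factor \<open>\<delta>\<close> each.
\<close>
lemma abs_sliding_int_pow_le_integral:
  assumes u: "locally_integrable u" and d: "0 < d" and \<delta>: "0 \<le> \<delta>"
  shows "\<bar>(sliding_int \<delta> d ^^ Suc k) u y\<bar> \<le> \<delta> ^ k / d * integral {y..y + real (Suc k) * (d * \<delta>)} (\<lambda>t. \<bar>u t\<bar>)"
proof (induction k arbitrary: y)
  case 0
  then show ?case using abs_sliding_int_le_integral[OF assms] by simp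
next
  case (Suc k)
  have i: "(\<lambda>t. \<bar>u t\<bar>) integrable_on {c..e}" for c e
    using locally_integrableD[OF locally_integrable_abs[OF u]] absolutely_integrable_on_def by blast
  let ?I = "integral {y..y + real (Suc (Suc k)) * (d * \<delta>)} (\<lambda>t. \<bar>u t\<bar>)"
  have "\<bar>sliding_int \<delta> d ((sliding_int \<delta> d ^^ Suc k) u) y\<bar> \<le> \<delta> * (\<delta> ^ k / d * ?I)"
  proof (rule abs_sliding_int_le[OF locally_integrable_sliding_int_pow[OF assms] d \<delta>])
    fix t assume t: "t \<in> {0..\<delta>}"
    have "{y + d * t..y + d * t + real (Suc k) * (d * \<delta>)} \<subseteq> {y..y + real (Suc (Suc k)) * (d * \<delta>)}"
      using t d by (auto simp: algebra_simps add_increasing2 intro: mult_left_mono)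
    then have "integral {y + d * t..y + d * t + real (Suc k) * (d * \<delta>)} (\<lambda>t. \<bar>u t\<bar>) \<le> ?I"
      by (intro integral_subset_le i) auto
    then have "\<delta> ^ k / d * integral {y + d * t..y + d * t + real (Suc k) * (d * \<delta>)} (\<lambda>t. \<bar>u t\<bar>) \<le> \<delta> ^ k / d * ?I"
      using d \<delta> by (intro mult_left_mono) auto
    then show "\<bar>(sliding_int \<delta> d ^^ Suc k) u (y + d * t)\<bar> \<le> \<delta> ^ k / d * ?I"
      using Suc.IH[of "y + d * t"] by linarith
  qed
  then show ?case by simp
qed

text \<open>
  By completeness of Lebesgue measure, either both functions are measurable or both integrals are \<open>0\<close>
  by convention.
\<close>
lemma integral_lebesgue_cong_AE:
  fixes f g :: "real \<Rightarrow> real"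
  assumes ae: "AE x in lebesgue. f x = g x"
  shows "(LINT x|lebesgue. f x) = (LINT x|lebesgue. g x)"
proof (cases "f \<in> borel_measurable lebesgue")
  case True
  then show ?thesis using borel_measurable_AE[OF True ae] ae by (intro integral_cong_AE)
next
  case False
  have "AE x in lebesgue. g x = f x" using ae by eventually_elim simp
  then have "g \<notin> borel_measurable lebesgue" using False borel_measurable_AE by blast
  then show ?thesis using False by (metis borel_measurable_integrable not_integrable_integral_eq)
qed

lemma sliding_int_cong_AE:
  assumes d: "0 < d" and uv: "AE t in lborel. t \<in> {y..y + d * \<delta>} \<longrightarrow> u t = v t"
  shows "sliding_int \<delta> d u y = sliding_int \<delta> d v y"
proof -
  obtain N where N: "N \<in> null_sets lborel" "\<And>t. t \<notin> N \<Longrightarrow> t \<in> {y..y + d * \<delta>} \<longrightarrow> u t = v t"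
    using uv by (auto elim!: AE_E3)
  have "AE t in lborel. y + d * t \<notin> N"
    using N(1) d by (intro AE_borel_affine[of d "\<lambda>x. x \<notin> N"]) (auto simp: AE_not_in null_sets_def)
  then have "AE t in lebesgue. y + d * t \<notin> N" by (rule AE_completion)
  then have "AE t in lebesgue. t \<in> {0..\<delta>} \<longrightarrow> u (y + d * t) = v (y + d * t)"
    by eventually_elim (use N(2) d in auto)
  then have ae: "AE t in lebesgue. indicator {0..\<delta>} t *\<^sub>R u (y + d * t) = indicator {0..\<delta>} t *\<^sub>R v (y + d * t)"
    by eventually_elim (auto simp: indicator_def)
  then show ?thesis unfolding sliding_int_def set_lebesgue_integral_def 
    by (rule integral_lebesgue_cong_AE)
qed

section \<open>Norms of sliding integrals and of differences\<close>

lemma Lp_le_borel_iff: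
  fixes u :: "real \<Rightarrow> real"
  assumes [measurable]: "u \<in> borel_measurable borel"
  shows "Lp_le p (lebesgue_on {c..e}) u C \<longleftrightarrow>
    0 \<le> C \<and> (\<integral>\<^sup>+x. indicator {c..e} x * ennreal (\<bar>u x\<bar> powr p) \<partial>lborel) \<le> ennreal (C powr p)"
proof -
  have "u \<in> borel_measurable lebesgue" using assms by (intro measurable_completion) simp
  then have m: "u \<in> borel_measurable (lebesgue_on {c..e})"
    by (rule measurable_restrict_space1)
  have "(\<integral>\<^sup>+x. ennreal (\<bar>u x\<bar> powr p) \<partial>lebesgue_on {c..e}) =
     (\<integral>\<^sup>+x. ennreal (\<bar>u x\<bar> powr p) * indicator {c..e} x \<partial>lebesgue)"
    by (subst nn_integral_restrict_space) auto
  also have "\<dots> = (\<integral>\<^sup>+x. indicator {c..e} x * ennreal (\<bar>u x\<bar> powr p) \<partial>lborel)"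
    unfolding nn_integral_completion by (simp add: mult.commute)
  finally show ?thesis unfolding Lp_le_def using m by simp
qed

lemma Lp_le_subinterval:
  fixes u :: "real \<Rightarrow> real"
  assumes u: "u \<in> borel_measurable borel" and L: "Lp_le p (lebesgue_on {c..e}) u C" and sub: "{c'..e'} \<subseteq> {c..e}"
  shows "Lp_le p (lebesgue_on {c'..e'}) u C"
proof -
  have "(\<integral>\<^sup>+x. indicator {c'..e'} x * ennreal (\<bar>u x\<bar> powr p) \<partial>lborel) \<le>
      (\<integral>\<^sup>+x. indicator {c..e} x * ennreal (\<bar>u x\<bar> powr p) \<partial>lborel)"
    using sub by (intro nn_integral_mono mult_right_mono) (auto simp: indicator_def)
  then show ?thesis
    using L unfolding Lp_le_borel_iff[OF u] by (meson order_trans)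
qed

lemma Lp_le_affine:
  fixes u :: "real \<Rightarrow> real"
  assumes u[measurable]: "u \<in> borel_measurable borel" and p: "1 \<le> p"
    and L: "Lp_le p (lebesgue_on {\<alpha> + l * c..\<alpha> + l * e}) u C" and l: "0 < l"
  shows "Lp_le p (lebesgue_on {c..e}) (\<lambda>x. u (\<alpha> + l * x)) (l powr (- 1 / p) * C)"
proof -
  have C: "0 \<le> C" using L by (simp add: Lp_le_def)
  let ?J = "\<integral>\<^sup>+x. indicator {c..e} x * ennreal (\<bar>u (\<alpha> + l * x)\<bar> powr p) \<partial>lborel"
  have "(\<integral>\<^sup>+x. indicator {\<alpha> + l * c..\<alpha> + l * e} x * ennreal (\<bar>u x\<bar> powr p) \<partial>lborel) =
     ennreal \<bar>l\<bar> * (\<integral>\<^sup>+x. indicator {\<alpha> + l * c..\<alpha> + l * e} (\<alpha> + l * x) * ennreal (\<bar>u (\<alpha> + l * x)\<bar> powr p) \<partial>lborel)"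
    using l by (intro nn_integral_real_affine) auto
  also have "(\<integral>\<^sup>+x. indicator {\<alpha> + l * c..\<alpha> + l * e} (\<alpha> + l * x) * ennreal (\<bar>u (\<alpha> + l * x)\<bar> powr p) \<partial>lborel) = ?J"
    using l by (intro nn_integral_cong) (auto simp: indicator_def)
  finally have "ennreal l * ?J \<le> ennreal (C powr p)"
    using L l unfolding Lp_le_borel_iff[OF u] by simp
  then have "ennreal (1 / l) * (ennreal l * ?J) \<le> ennreal (1 / l) * ennreal (C powr p)"
    by (rule mult_left_mono) simp
  moreover have "ennreal (1 / l) * (ennreal l * ?J) = ?J"
    using l by (simp add: mult.assoc[symmetric] ennreal_mult[symmetric])
  moreover have "ennreal (1 / l) * ennreal (C powr p) = ennreal ((l powr (- 1 / p) * C) powr p)"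
  proof -
    have "(l powr (- 1 / p)) powr p = 1 / l"
      using l p by (simp only: powr_powr) (simp add: powr_minus_divide)
    then show ?thesis using l C by (simp add: powr_mult ennreal_mult[symmetric])
  qed
  ultimately have "?J \<le> ennreal ((l powr (- 1 / p) * C) powr p)" by simp
  then show ?thesis using C by (subst Lp_le_borel_iff) auto
qed

lemma Lp_le_shift:
  fixes u :: "real \<Rightarrow> real"
  assumes "u \<in> borel_measurable borel" "1 \<le> p" "Lp_le p (lebesgue_on {c + t..e + t}) u C"
  shows "Lp_le p (lebesgue_on {c..e}) (\<lambda>x. u (x + t)) C"
  using Lp_le_affine[of u p t 1 c e C] assms by (simp add: add.commute)

lemma borel_measurable_sliding_int:
  "locally_integrable u \<Longrightarrow> 0 < d \<Longrightarrow> 0 \<le> \<delta> \<Longrightarrow> sliding_int \<delta> d u \<in> borel_measurable borel"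
  by (intro borel_measurable_continuous_onI sliding_int_continuous)

lemma ennreal_powr_integral_Icc_le:
  fixes w :: "real \<Rightarrow> real"
  assumes w: "w absolutely_integrable_on {0..\<delta>}" and [measurable]: "w \<in> borel_measurable borel"
    and p: "1 \<le> p" and \<delta>: "0 \<le> \<delta>"
  shows "ennreal (\<bar>LINT t:{0..\<delta>}|lebesgue. w t\<bar> powr p) \<le>
     ennreal (\<delta> powr (p - 1)) * (\<integral>\<^sup>+t. indicator {0..\<delta>} t * ennreal (\<bar>w t\<bar> powr p) \<partial>lborel)"
proof -
  let ?M = "lebesgue_on {0..\<delta>}"
  have "integrable ?M w" using w by (simp add: set_integrable_def integrable_restrict_space)
  moreover have "finite_measure ?M"
    by (intro finite_measureI) (simp add: emeasure_restrict_space emeasure_lborel_Icc[OF \<delta>])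
  ultimately have "ennreal (\<bar>LINT t|?M. w t\<bar> powr p) \<le>
      ennreal (measure ?M (space ?M) powr (p - 1)) * (\<integral>\<^sup>+t. ennreal (\<bar>w t\<bar> powr p) \<partial>?M)"
    using p by (intro ennreal_powr_integral_le)
  moreover have "measure ?M (space ?M) = \<delta>" using \<delta> by (simp add: measure_restrict_space)
  moreover have "(LINT t|?M. w t) = (LINT t:{0..\<delta>}|lebesgue. w t)"
    by (simp add: integral_restrict_space set_lebesgue_integral_def)
  moreover have "(\<integral>\<^sup>+t. ennreal (\<bar>w t\<bar> powr p) \<partial>?M) = (\<integral>\<^sup>+t. indicator {0..\<delta>} t * ennreal (\<bar>w t\<bar> powr p) \<partial>lborel)"
    by (simp add: nn_integral_restrict_space nn_integral_completion mult.commute)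
  ultimately show ?thesis by simp
qed

text \<open>
  A sliding integral is an integral of translates of \<open>u\<close>, each with norm at most \<open>C\<close>; Jensen's
  inequality and Tonelli's theorem turn this into the bound \<open>\<delta> * C\<close>. The interval grows by the largest
  translation \<open>d * \<delta>\<close>.
\<close>
lemma Lp_le_sliding_int:
  fixes u :: "real \<Rightarrow> real"
  assumes u[measurable]: "u \<in> borel_measurable borel" and loc: "locally_integrable u" and p: "1 \<le> p"
    and d: "0 < d" and \<delta>: "0 < \<delta>"
    and L: "Lp_le p (lebesgue_on {c..e + d * \<delta>}) u C"
  shows "Lp_le p (lebesgue_on {c..e}) (sliding_int \<delta> d u) (\<delta> * C)"
proof -
  have C: "0 \<le> C" using L by (simp add: Lp_le_def)
  have "(\<integral>\<^sup>+y. indicator {c..e} y * ennreal (\<bar>sliding_int \<delta> d u y\<bar> powr p) \<partial>lborel) \<le>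
     (\<integral>\<^sup>+y. indicator {c..e} y * (ennreal (\<delta> powr (p - 1)) *
        (\<integral>\<^sup>+t. indicator {0..\<delta>} t * ennreal (\<bar>u (y + d * t)\<bar> powr p) \<partial>lborel)) \<partial>lborel)"
    unfolding sliding_int_def using \<delta>
    by (intro nn_integral_mono mult_left_mono ennreal_powr_integral_Icc_le p
        locally_integrableD[OF locally_integrable_affine[OF loc d]]) auto
  also have "\<dots> = ennreal (\<delta> powr (p - 1)) * (\<integral>\<^sup>+y. (\<integral>\<^sup>+t. indicator {c..e} y * (indicator {0..\<delta>} t *
        ennreal (\<bar>u (y + d * t)\<bar> powr p)) \<partial>lborel) \<partial>lborel)"
    by (simp add: nn_integral_cmult[symmetric] mult.left_commute)
  also have "(\<integral>\<^sup>+y. (\<integral>\<^sup>+t. indicator {c..e} y * (indicator {0..\<delta>} t *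
        ennreal (\<bar>u (y + d * t)\<bar> powr p)) \<partial>lborel) \<partial>lborel) =
     (\<integral>\<^sup>+t. (\<integral>\<^sup>+y. indicator {c..e} y * (indicator {0..\<delta>} t *
        ennreal (\<bar>u (y + d * t)\<bar> powr p)) \<partial>lborel) \<partial>lborel)"
    by (rule lborel_pair.Fubini') measurable
  also have "\<dots> \<le> (\<integral>\<^sup>+t. indicator {0..\<delta>} t * ennreal (C powr p) \<partial>lborel)"
  proof (rule nn_integral_mono)
    fix t
    show "(\<integral>\<^sup>+y. indicator {c..e} y * (indicator {0..\<delta>} t * ennreal (\<bar>u (y + d * t)\<bar> powr p)) \<partial>lborel)
       \<le> indicator {0..\<delta>} t * ennreal (C powr p)"
    proof (cases "t \<in> {0..\<delta>}")
      case True
      have "{c + d * t..e + d * t} \<subseteq> {c..e + d * \<delta>}"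
        using True d by (auto intro: add_increasing2 mult_nonneg_nonneg add_mono mult_left_mono)
      then have "Lp_le p (lebesgue_on {c..e}) (\<lambda>y. u (y + d * t)) C"
        by (intro Lp_le_shift u p Lp_le_subinterval[OF u L])
      then have "(\<integral>\<^sup>+y. indicator {c..e} y * ennreal (\<bar>u (y + d * t)\<bar> powr p) \<partial>lborel) \<le> ennreal (C powr p)"
        by (subst (asm) Lp_le_borel_iff) auto
      then show ?thesis using True by simp
    qed simp
  qed
  also have "(\<integral>\<^sup>+t. indicator {0..\<delta>} t * ennreal (C powr p) \<partial>lborel) = ennreal (\<delta> * C powr p)"
    using \<delta> by (simp add: nn_integral_multc ennreal_mult)
  also have "ennreal (\<delta> powr (p - 1)) * ennreal (\<delta> * C powr p) = ennreal ((\<delta> * C) powr p)"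
    using \<delta> C by (simp add: ennreal_mult[symmetric] powr_mult powr_diff)
  finally have "(\<integral>\<^sup>+y. indicator {c..e} y * ennreal (\<bar>sliding_int \<delta> d u y\<bar> powr p) \<partial>lborel) \<le> ennreal ((\<delta> * C) powr p)"
    by (simp add: mult_left_mono)
  then show ?thesis
    using C \<delta> by (subst Lp_le_borel_iff) (auto intro!: borel_measurable_sliding_int loc d)
qed

lemma borel_measurable_sliding_int_pow:
  assumes "u \<in> borel_measurable borel" "locally_integrable u" "0 < d" "0 \<le> \<delta>"
  shows "(sliding_int \<delta> d ^^ k) u \<in> borel_measurable borel"
  using assms by (cases k) (auto intro!: borel_measurable_sliding_int locally_integrable_sliding_int_pow)

lemma Lp_le_sliding_int_pow:
  fixes u :: "real \<Rightarrow> real"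
  assumes "u \<in> borel_measurable borel" "locally_integrable u" "1 \<le> p" "0 < d" "0 < \<delta>"
    and L: "Lp_le p (lebesgue_on {c..e + real k * (d * \<delta>)}) u C"
  shows "Lp_le p (lebesgue_on {c..e}) ((sliding_int \<delta> d ^^ k) u) (\<delta> ^ k * C)"
  using L
proof (induction k arbitrary: e)
  case (Suc k)
  have "Lp_le p (lebesgue_on {c..(e + d * \<delta>) + real k * (d * \<delta>)}) u C"
    using Suc.prems by (simp add: algebra_simps)
  then have "Lp_le p (lebesgue_on {c..e + d * \<delta>}) ((sliding_int \<delta> d ^^ k) u) (\<delta> ^ k * C)"
    by (rule Suc.IH)
  then have "Lp_le p (lebesgue_on {c..e}) (sliding_int \<delta> d ((sliding_int \<delta> d ^^ k) u)) (\<delta> * (\<delta> ^ k * C))"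
    using assms by (intro Lp_le_sliding_int borel_measurable_sliding_int_pow locally_integrable_sliding_int_pow) auto
  then show ?case by (simp add: mult.assoc)
qed simp

lemma borel_measurable_fwd_diff [measurable]:
  assumes [measurable]: "g \<in> borel_measurable borel"
  shows "fwd_diff s h g \<in> borel_measurable borel"
  unfolding fwd_diff_def by measurable

text \<open>
  One more difference at most doubles the norm, as \<open>fwd_diff (Suc m) h g\<close> is the difference of two translates
  of \<open>fwd_diff m h g\<close>, both on the interval where that function is controlled.
\<close>
lemma Lp_le_fwd_diff_raise:
  fixes g :: "real \<Rightarrow> real"
  assumes g: "g \<in> borel_measurable borel" and p: "1 \<le> p" and h: "0 < h"
    and L: "Lp_le p (lebesgue_on {a..b - real s * h}) (fwd_diff s h g) C"
  shows "Lp_le p (lebesgue_on {a..b - real (s + k) * h}) (fwd_diff (s + k) h g) (2 ^ k * C)"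
proof (induction k)
  case (Suc k)
  let ?I = "{a..b - real (s + Suc k) * h}"
  note bor = borel_measurable_fwd_diff[OF g, of "s + k" h]
  have "{a + h..b - real (s + Suc k) * h + h} \<subseteq> {a..b - real (s + k) * h}"
    using h by (auto simp: algebra_simps)
  then have "Lp_le p (lebesgue_on ?I) (\<lambda>x. fwd_diff (s + k) h g (x + h)) (2 ^ k * C)"
    by (intro Lp_le_shift bor p Lp_le_subinterval[OF bor Suc])
  moreover have "?I \<subseteq> {a..b - real (s + k) * h}"
    using h by (auto simp: algebra_simps)
  then have "Lp_le p (lebesgue_on ?I) (fwd_diff (s + k) h g) (2 ^ k * C)"
    by (rule Lp_le_subinterval[OF bor Suc])
  ultimately have "Lp_le p (lebesgue_on ?I) (\<lambda>x. fwd_diff (s + k) h g (x + h) - fwd_diff (s + k) h g x) (2 ^ k * C + 2 ^ k * C)"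
    using p by (rule Lp_le_diff)
  then show ?case by (simp add: fwd_diff_Suc[abs_def] mult_ac)
qed (use L in simp)

text \<open>
  The supremum defining the modulus is over a set bounded by \<open>2 ^ s * C\<close>, so every member is below it.
\<close>
lemma fwd_diff_le_modulus:
  fixes g :: "real \<Rightarrow> real"
  assumes g: "g \<in> borel_measurable borel" and p: "1 \<le> p" and L: "Lp_le p (lebesgue_on {a..b}) g C"
    and h: "0 < h" "h \<le> \<eta>"
  shows "Lp_le p (lebesgue_on {a..b - real s * h}) (fwd_diff s h g) (modulus_smoothness s p a b g \<eta>)"
proof -
  define T where "T h = (LINT x:{a..b - real s * h}|lebesgue. \<bar>fwd_diff s h g x\<bar> powr p) powr (1 / p)" for h
  have T: "T h = (LINT x|lebesgue_on {a..b - real s * h}. \<bar>fwd_diff s h g x\<bar> powr p) powr (1 / p)" for h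
    by (simp add: T_def integral_restrict_space set_lebesgue_integral_def)
  have bound: "Lp_le p (lebesgue_on {a..b - real s * h}) (fwd_diff s h g) (2 ^ s * C)" if "0 < h" for h
  proof -
    have "Lp_le p (lebesgue_on {a..b - real 0 * h}) (fwd_diff 0 h g) C"
      using L by (simp add: fwd_diff_0[abs_def])
    from Lp_le_fwd_diff_raise[OF g p that this, of s] show ?thesis by simp
  qed
  have "T h \<le> (SUP h\<in>{0<..\<eta>}. T h)"
  proof (rule cSUP_upper)
    show "bdd_above (T ` {0<..\<eta>})"
      using bound unfolding Lp_le_iff_norm[OF p] T by (intro bdd_aboveI[of _ "2 ^ s * C"]) auto
  qed (use h in auto)
  then have "T h \<le> modulus_smoothness s p a b g \<eta>"
    by (simp add: modulus_smoothness_def T_def)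
  then show ?thesis
    using bound[OF h(1)] unfolding Lp_le_iff_norm[OF p] T by auto
qed

section \<open>Smoothness of Steklov averages\<close>

definition steklov_coeff :: "real \<Rightarrow> nat \<Rightarrow> nat \<Rightarrow> real" where
  "steklov_coeff \<delta> r m = (- \<delta>) powi (- int r) * ((-1) ^ (r - m + 1) * real (r choose (r - m)))"

lemma abs_steklov_coeff:
  assumes "0 < \<delta>" "m \<le> r"
  shows "\<bar>steklov_coeff \<delta> r m\<bar> = real (r choose m) / \<delta> ^ r"
  using assms
  by (simp add: steklov_coeff_def abs_mult power_int_minus power_abs binomial_symmetric[of m r] divide_inverse
      power_inverse mult.commute)

text \<open>
  In the \<open>m\<close>-th summand the argument \<open>x + m * \<theta>\<close> is \<open>z + (m / r) * (t\<^sub>1 + \<dots> + t\<^sub>r)\<close>, where \<open>z\<close> is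
  the image of \<open>x\<close> under the affine map with fixed point \<open>a\<close> and slope \<open>1 - m * \<delta> / (b - a)\<close>.
\<close>
lemma steklov_eq_sum_sliding_int:
  assumes ab: "a < b" and r: "1 \<le> r" and \<delta>: "0 < \<delta>" and g: "locally_integrable g"
  shows "steklov a b \<delta> r g x =
    (\<Sum>m=1..r. steklov_coeff \<delta> r m * (sliding_int \<delta> (real m / real r) ^^ r) g (a + (1 - real m * \<delta> / (b - a)) * (x - a)))"
proof -
  let ?c = "\<lambda>m. (-1) ^ (r - m + 1) * real (r choose (r - m))"
  let ?z = "\<lambda>m. a + (1 - real m * \<delta> / (b - a)) * (x - a)"
  have arg: "x + real m * steklov_theta a b \<delta> r x ts = ?z m + real m / real r * sum_list ts" for m ts
    unfolding steklov_theta_def by (simp add: algebra_simps)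
  have "iter_integral \<delta> r (\<lambda>ts. \<Sum>m=1..r. ?c m * g (?z m + real m / real r * sum_list ts)) =
     (\<Sum>m=1..r. ?c m * (sliding_int \<delta> (real m / real r) ^^ r) g (?z m))"
    using assms by (intro iter_integral_sliding_int) auto
  then show ?thesis
    unfolding steklov_def arg by (simp add: sum_distrib_left steklov_coeff_def mult.assoc)
qed

text \<open>
  The function \<open>G j\<close> of the proof is the \<open>j\<close>-th derivative: \<open>j\<close> of the \<open>r\<close> sliding integrals are replaced by
  difference quotients, and every differentiation brings out a factor \<open>l m\<close>. The slopes \<open>l m\<close> lie in
  \<open>[0, 1]\<close>, and the affine maps send \<open>[a, b]\<close> to \<open>[a, b - m * \<delta>]\<close>. On that interval the \<open>r - s\<close> remaining
  integrations use the difference of order \<open>s\<close> with step \<open>d m * \<delta>\<close> exactly on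
  \<open>[a, b - s * (d m * \<delta>)]\<close>, where it has norm at most \<open>\<Omega>\<close> by assumption.
\<close>
lemma steklov_Sobolev_space:
  fixes g :: "real \<Rightarrow> real"
  assumes ab: "a < b" and s: "1 \<le> s" "s \<le> r" and p: "1 \<le> p" and \<delta>: "0 < \<delta>" "real r * \<delta> \<le> b - a"
    and g: "g \<in> borel_measurable borel" "locally_integrable g"
    and om: "\<And>h. 0 < h \<Longrightarrow> h \<le> \<delta> \<Longrightarrow> Lp_le p (lebesgue_on {a..b - real s * h}) (fwd_diff s h g) \<Omega>"
    and f: "\<And>x. x \<in> {a..b} \<Longrightarrow> f x = steklov a b \<delta> r g x"
  shows "f \<in> Sobolev_space s p a b"
    and "Lp_norm p a b (iter_deriv a b s f) \<le> 2 ^ r * real r ^ s / \<delta> ^ s * \<Omega>"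
proof -
  have r: "1 \<le> r" using s by simp
  have \<Omega>: "0 \<le> \<Omega>" using om[of \<delta>] \<delta> by (simp add: Lp_le_def)
  define d where "d m = real m / real r" for m
  define l where "l m = 1 - real m * \<delta> / (b - a)" for m
  define V where "V j m = (sliding_int \<delta> (d m) ^^ (r - j)) ((dquot \<delta> (d m) ^^ j) g)" for j m
  define G where "G j x = (\<Sum>m=1..r. steklov_coeff \<delta> r m * (l m ^ j * V j m (a + l m * (x - a))))" for j x
  have d: "0 < d m" "d m \<le> 1" if "m \<in> {1..r}" for m using that r by (auto simp: d_def)
  have l: "0 \<le> l m" "l m \<le> 1" if "m \<in> {1..r}" for m
  proof -
    have "real m * \<delta> \<le> real r * \<delta>" using that \<delta> by (intro mult_right_mono) auto
    then have "real m * \<delta> \<le> b - a" using \<delta>(2) by linarith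
    then show "0 \<le> l m" using ab by (simp add: l_def)
    show "l m \<le> 1" using \<delta> ab by (simp add: l_def)
  qed
  have V_prim: "primitive_on c e (V j m) (V (Suc j) m)" if "m \<in> {1..r}" "j < s" for c e j m
  proof -
    have k: "r - j = Suc (r - Suc j)" using that s by simp
    let ?v = "(dquot \<delta> (d m) ^^ j) g"
    have loc: "locally_integrable ?v" by (rule locally_integrable_dquot_pow[OF g(2)])
    have "primitive_on c e (sliding_int \<delta> (d m) ((sliding_int \<delta> (d m) ^^ (r - Suc j)) ?v)) (dquot \<delta> (d m) ((sliding_int \<delta> (d m) ^^ (r - Suc j)) ?v))"
      using d that \<delta> by (intro sliding_int_primitive_on locally_integrable_sliding_int_pow loc) auto
    then show ?thesis
      using sliding_int_pow_dquot[OF loc, of "d m" \<delta> "r - Suc j"] d[OF that(1)] \<delta> by (simp add: V_def k)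
  qed
  have shift: "a + l m * (x - a) = (a - l m * a) + l m * x" for m x by (simp add: algebra_simps)
  have prim: "primitive_on a b (G j) (G (Suc j))" if j: "j < s" for j
  proof -
    have "primitive_on a b (\<lambda>x. steklov_coeff \<delta> r m * (l m ^ j * V j m (a + l m * (x - a))))
       (\<lambda>x. steklov_coeff \<delta> r m * (l m ^ j * (l m * V (Suc j) m (a + l m * (x - a)))))" if "m \<in> {1..r}" for m
      unfolding shift using l that j by (intro primitive_on_cmult primitive_on_affine V_prim) auto
    then have "primitive_on a b (\<lambda>x. \<Sum>m=1..r. steklov_coeff \<delta> r m * (l m ^ j * V j m (a + l m * (x - a))))
       (\<lambda>x. \<Sum>m=1..r. steklov_coeff \<delta> r m * (l m ^ j * (l m * V (Suc j) m (a + l m * (x - a)))))"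
      by (intro primitive_on_sum) auto
    then show ?thesis unfolding G_def by (simp add: mult_ac)
  qed
  have cont: "continuous_on {a..b} (G j)" if "j < s" for j
    by (rule primitive_on_continuous[OF prim[OF that]])
  have V_bound: "Lp_le p (lebesgue_on {a..b - real m * \<delta>}) (V s m) (\<delta> ^ (r - s) * (\<Omega> / d m ^ s))"
    and V_borel: "V s m \<in> borel_measurable borel" if m: "m \<in> {1..r}" for m
  proof -
    have h: "0 < d m * \<delta>" "d m * \<delta> \<le> \<delta>" using d[OF m] \<delta> by (auto simp: mult_le_cancel_right2)
    have eq: "(dquot \<delta> (d m) ^^ s) g = (\<lambda>x. 1 / d m ^ s * fwd_diff s (d m * \<delta>) g x)"
      using dquot_pow[OF d(1)[OF m]] by auto
    have bor: "(dquot \<delta> (d m) ^^ s) g \<in> borel_measurable borel"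
      unfolding eq using g(1) by measurable
    have loc: "locally_integrable ((dquot \<delta> (d m) ^^ s) g)" by (rule locally_integrable_dquot_pow[OF g(2)])
    have "Lp_le p (lebesgue_on {a..b - real s * (d m * \<delta>)}) ((dquot \<delta> (d m) ^^ s) g) (\<bar>1 / d m ^ s\<bar> * \<Omega>)"
      unfolding eq by (intro Lp_le_cmult om h)
    moreover have "b - real s * (d m * \<delta>) = b - real m * \<delta> + real (r - s) * (d m * \<delta>)"
      using s r by (simp add: d_def of_nat_diff field_simps)
    ultimately have "Lp_le p (lebesgue_on {a..b - real m * \<delta> + real (r - s) * (d m * \<delta>)})
       ((dquot \<delta> (d m) ^^ s) g) (\<Omega> / d m ^ s)"
      using d[OF m] by simp
    then show "Lp_le p (lebesgue_on {a..b - real m * \<delta>}) (V s m) (\<delta> ^ (r - s) * (\<Omega> / d m ^ s))"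
      unfolding V_def using d[OF m] \<delta> p by (intro Lp_le_sliding_int_pow bor loc) auto
    show "V s m \<in> borel_measurable borel"
      unfolding V_def using d[OF m] \<delta> by (intro borel_measurable_sliding_int_pow bor loc) auto
  qed
  have term_bound: "Lp_le p (lebesgue_on {a..b}) (\<lambda>x. steklov_coeff \<delta> r m * (l m ^ s * V s m (a + l m * (x - a))))
      (real (r choose m) * (real r ^ s / \<delta> ^ s * \<Omega>))" if m: "m \<in> {1..r}" for m
  proof -
    let ?C = "\<delta> ^ (r - s) * (\<Omega> / d m ^ s)"
    have C: "0 \<le> ?C" using \<Omega> \<delta> d[OF m] by simp
    have "Lp_le p (lebesgue_on {a..b}) (\<lambda>x. l m ^ s * V s m (a + l m * (x - a))) ?C"
    \<comment> \<open>the affine map is constant if \<open>m = r\<close> and \<open>r * \<delta> = b - a\<close>; the factor \<open>l m ^ s\<close> then vanishes as \<open>s \<ge> 1\<close>\<close>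
    proof (cases "l m = 0")
      case True
      then show ?thesis using s Lp_le_mono[OF Lp_le_zero[OF p] C p] by (simp add: power_0_left)
    next
      case False
      then have lp: "0 < l m" "l m \<le> 1" using l[OF m] by auto
      have "l m * (b - a) = b - a - real m * \<delta>"
        using ab by (simp add: l_def left_diff_distrib)
      then have "(a - l m * a) + l m * b = b - real m * \<delta>" by (simp add: algebra_simps)
      then have "{(a - l m * a) + l m * a..(a - l m * a) + l m * b} = {a..b - real m * \<delta>}" by simp
      then have "Lp_le p (lebesgue_on {a..b}) (\<lambda>x. V s m ((a - l m * a) + l m * x)) (l m powr (- 1 / p) * ?C)"
        using V_bound[OF m] lp by (intro Lp_le_affine V_borel m p) auto
      then have "Lp_le p (lebesgue_on {a..b}) (\<lambda>x. l m ^ s * V s m (a + l m * (x - a)))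
          (\<bar>l m ^ s\<bar> * (l m powr (- 1 / p) * ?C))"
        unfolding shift by (rule Lp_le_cmult)
      \<comment> \<open>the derivative factor \<open>l m ^ s\<close> outweighs the loss from the substitution, as \<open>1 / p \<le> 1 \<le> s\<close>\<close>
      moreover have "\<bar>l m ^ s\<bar> * (l m powr (- 1 / p) * ?C) \<le> ?C"
      proof -
        have "\<bar>l m ^ s\<bar> * l m powr (- 1 / p) = l m powr (real s - 1 / p)"
          using lp by (simp add: powr_realpow[symmetric] powr_add[symmetric])
        also have "\<dots> \<le> 1"
        proof (rule powr_le1)
          have "1 / p \<le> 1" using p by simp
          moreover have "1 \<le> real s" using s by simp
          ultimately show "0 \<le> real s - 1 / p" by linarith
        qed (use lp in auto)
        finally have "\<bar>l m ^ s\<bar> * l m powr (- 1 / p) * ?C \<le> 1 * ?C" using C by (rule mult_right_mono)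
        then show ?thesis by (simp only: mult.assoc mult_1)
      qed
      ultimately show ?thesis using p by (rule Lp_le_mono)
    qed
    then have "Lp_le p (lebesgue_on {a..b}) (\<lambda>x. steklov_coeff \<delta> r m * (l m ^ s * V s m (a + l m * (x - a))))
      (\<bar>steklov_coeff \<delta> r m\<bar> * ?C)" by (rule Lp_le_cmult)
    moreover have "\<bar>steklov_coeff \<delta> r m\<bar> * ?C \<le> real (r choose m) * (real r ^ s / \<delta> ^ s * \<Omega>)"
    proof -
      have "1 / d m ^ s \<le> real r ^ s"
      proof -
        have "(1 / d m) ^ s \<le> real r ^ s"
          using m r by (intro power_mono) (auto simp: d_def divide_le_eq)
        then show ?thesis by (simp add: power_one_over)
      qed
      then have "\<Omega> * (1 / d m ^ s) \<le> \<Omega> * real r ^ s" using \<Omega> by (rule mult_left_mono)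
      then have *: "\<Omega> / d m ^ s \<le> \<Omega> * real r ^ s" by simp
      have "\<delta> ^ r = \<delta> ^ (r - s) * \<delta> ^ s" using s by (simp add: power_add[symmetric])
      then have "\<bar>steklov_coeff \<delta> r m\<bar> * ?C = real (r choose m) / \<delta> ^ s * (\<Omega> / d m ^ s)"
        using m \<delta> by (simp add: abs_steklov_coeff)
      also have "\<dots> \<le> real (r choose m) / \<delta> ^ s * (\<Omega> * real r ^ s)"
        using * \<delta> by (intro mult_left_mono) auto
      finally show ?thesis by (simp add: mult_ac)
    qed
    ultimately show ?thesis using p by (rule Lp_le_mono)
  qed
  have "Lp_le p (lebesgue_on {a..b}) (G s) (\<Sum>m=1..r. real (r choose m) * (real r ^ s / \<delta> ^ s * \<Omega>))"
    unfolding G_def using p by (intro Lp_le_sum term_bound) auto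
  moreover have "(\<Sum>m=1..r. real (r choose m) * (real r ^ s / \<delta> ^ s * \<Omega>)) \<le> 2 ^ r * real r ^ s / \<delta> ^ s * \<Omega>"
  proof -
    have "(\<Sum>m=1..r. real (r choose m)) \<le> (\<Sum>m\<le>r. real (r choose m))"
      by (intro sum_mono2) auto
    also have "\<dots> = 2 ^ r" using choose_row_sum[of r] by (metis of_nat_numeral of_nat_power of_nat_sum)
    finally have "(\<Sum>m=1..r. real (r choose m)) * (real r ^ s / \<delta> ^ s * \<Omega>) \<le> 2 ^ r * (real r ^ s / \<delta> ^ s * \<Omega>)"
      using \<Omega> \<delta> by (intro mult_right_mono) auto
    moreover have "2 ^ r * real r ^ s / \<delta> ^ s * \<Omega> = 2 ^ r * (real r ^ s / \<delta> ^ s * \<Omega>)" by simp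
    ultimately show ?thesis by (simp only: sum_distrib_right[symmetric])
  qed
  ultimately have Gs: "Lp_le p (lebesgue_on {a..b}) (G s) (2 ^ r * real r ^ s / \<delta> ^ s * \<Omega>)"
    using p by (rule Lp_le_mono)
  then have Lp: "G s \<in> Lp_space p a b" "Lp_norm p a b (G s) \<le> 2 ^ r * real r ^ s / \<delta> ^ s * \<Omega>"
    using Lp_le_iff_Lp_space[OF p] by blast+
  have f0: "f x = G 0 x" if "x \<in> {a..b}" for x
    unfolding f[OF that] steklov_eq_sum_sliding_int[OF ab r \<delta>(1) g(2)] G_def V_def d_def l_def by simp
  show "f \<in> Sobolev_space s p a b"
    by (rule Sobolev_space_chain(1)[OF ab s(1) p prim cont Lp(1) f0])
  show "Lp_norm p a b (iter_deriv a b s f) \<le> 2 ^ r * real r ^ s / \<delta> ^ s * \<Omega>"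
    using Sobolev_space_chain(3)[OF ab s(1) p prim cont Lp(1) f0] Lp(2) by simp
qed

section \<open>Approximation by Steklov averages\<close>

lemma sliding_int_pow_one:
  assumes "0 \<le> \<delta>"
  shows "(sliding_int \<delta> d ^^ k) (\<lambda>_. 1) = (\<lambda>_. \<delta> ^ k)"
proof (induction k)
  case (Suc k)
  have "sliding_int \<delta> d (\<lambda>_. c) = (\<lambda>_. \<delta> * c)" for c
    using assms by (auto simp: sliding_int_def set_lebesgue_integral_def)
  then show ?case using Suc by simp
qed simp

text \<open>
  The shift that moves the range \<open>[0, \<delta>]\<close> of the steps to the part of \<open>[-\<delta>, \<delta>]\<close> that is admissible at \<open>x\<close>:
  only forward steps at \<open>a\<close>, only backward steps at \<open>b\<close>.
\<close>
definition steklov_offset :: "real \<Rightarrow> real \<Rightarrow> real \<Rightarrow> real \<Rightarrow> real" where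
  "steklov_offset a b \<delta> x = (x - a) / (b - a) * \<delta>"

lemma locally_integrable_fwd_diff_step:
  assumes g: "locally_integrable g"
  shows "locally_integrable (\<lambda>u. fwd_diff r (u - \<kappa>) g x)"
  unfolding fwd_diff_def
proof (intro locally_integrable_sum locally_integrable_cmult finite_atLeastAtMost)
  fix k assume "k \<in> {0..r}"
  show "locally_integrable (\<lambda>u. g (x + real k * (u - \<kappa>)))"
  proof (cases "k = 0")
    case False
    have "locally_integrable (\<lambda>u. g ((x - real k * \<kappa>) + real k * u))"
      using False by (intro locally_integrable_affine g) auto
    then show ?thesis by (simp add: algebra_simps)
  qed (simp add: locally_integrable_const)
qed

text \<open>
  The sum in the Steklov average lacks the term \<open>m = 0\<close> of the difference of order \<open>r\<close>. Its sign is
  chosen so that this missing term, integrated and normalised, is \<open>g x\<close>.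
\<close>
lemma steklov_minus_eq_sliding_int:
  assumes r: "1 \<le> r" and \<delta>: "0 < \<delta>" and g: "locally_integrable g"
  shows "steklov a b \<delta> r g x - g x = - ((- \<delta>) powi (- int r)) *
    (sliding_int \<delta> (1 / real r) ^^ r) (\<lambda>u. fwd_diff r (u - steklov_offset a b \<delta> x) g x) 0"
proof -
  let ?k = "steklov_offset a b \<delta> x"
  let ?D = "\<lambda>u. fwd_diff r (u - ?k) g x"
  \<comment> \<open>index \<open>0\<close> is the constant term \<open>g x\<close>, index \<open>1\<close> the full difference of order \<open>r\<close>\<close>
  define u where "u i = (if i = (0::nat) then (\<lambda>_. 1) else ?D)" for i
  define c where "c i = (if i = (0::nat) then (-1) ^ r * g x else - 1)" for i
  have eq: "(\<Sum>m=1..r. (-1) ^ (r - m + 1) * real (r choose (r - m)) * g (x + real m * steklov_theta a b \<delta> r x ts)) =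
     (\<Sum>i\<in>{0,1}. c i * u i (0 + 1 / real r * sum_list ts))" for ts
  proof -
    let ?t = "steklov_theta a b \<delta> r x ts"
    have "(\<Sum>m=1..r. (-1) ^ (r - m + 1) * real (r choose (r - m)) * g (x + real m * ?t)) =
       - (\<Sum>m=1..r. real (r choose m) * (-1) ^ (r - m) * g (x + real m * ?t))"
      by (auto simp: sum_negf[symmetric] binomial_symmetric[symmetric] intro!: sum.cong)
    moreover have "fwd_diff r ?t g x = (-1) ^ r * g x + (\<Sum>m=1..r. real (r choose m) * (-1) ^ (r - m) * g (x + real m * ?t))"
      unfolding fwd_diff_def by (simp add: sum.atLeast_Suc_atMost)
    moreover have "?t = 1 / real r * sum_list ts - ?k"
      by (simp add: steklov_theta_def steklov_offset_def)
    ultimately show ?thesis by (simp add: c_def u_def)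
  qed
  have "iter_integral \<delta> r (\<lambda>ts. \<Sum>i\<in>{0,1}. c i * u i (0 + 1 / real r * sum_list ts)) =
     (\<Sum>i\<in>{0,1}. c i * (sliding_int \<delta> (1 / real r) ^^ r) (u i) 0)"
    using r \<delta> by (intro iter_integral_sliding_int)
      (auto simp: u_def locally_integrable_const locally_integrable_fwd_diff_step[OF g])
  also have "\<dots> = (-1) ^ r * g x * \<delta> ^ r - (sliding_int \<delta> (1 / real r) ^^ r) ?D 0"
    using \<delta> by (simp add: c_def u_def sliding_int_pow_one)
  finally have "steklov a b \<delta> r g x = (- \<delta>) powi (- int r) * ((-1) ^ r * g x * \<delta> ^ r - (sliding_int \<delta> (1 / real r) ^^ r) ?D 0)"
    unfolding steklov_def eq by simp
  moreover have "(- \<delta>) powi (- int r) * ((-1) ^ r * \<delta> ^ r) = 1"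
    using \<delta> by (simp add: power_int_minus power_mult_distrib[symmetric])
  then have "(- \<delta>) powi (- int r) * ((-1) ^ r * g x * \<delta> ^ r) = g x"
    by (metis (no_types, opaque_lifting) mult.assoc mult.commute mult.left_neutral)
  ultimately show ?thesis by (simp add: right_diff_distrib)
qed

text \<open>
  The step is a mean of the \<open>r\<close> variables, so the \<open>r\<close>-fold integral reduces to a simple integral
  over the step, to which Jensen's inequality applies.
\<close>
lemma ennreal_steklov_minus_le:
  assumes r: "1 \<le> r" and \<delta>: "0 < \<delta>" and p: "1 \<le> p" and g: "g \<in> borel_measurable borel" "locally_integrable g"
  shows "ennreal (\<bar>steklov a b \<delta> r g x - g x\<bar> powr p) \<le> ennreal (real r powr p / \<delta>) *
     (\<integral>\<^sup>+u. indicator {0..\<delta>} u * ennreal (\<bar>fwd_diff r (u - steklov_offset a b \<delta> x) g x\<bar> powr p) \<partial>lborel)"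
proof -
  let ?D = "\<lambda>u. fwd_diff r (u - steklov_offset a b \<delta> x) g x"
  have [measurable]: "g \<in> borel_measurable borel" by fact
  have D: "locally_integrable ?D" by (rule locally_integrable_fwd_diff_step[OF g(2)])
  have Db: "(\<lambda>u. \<bar>?D u\<bar>) \<in> borel_measurable borel" unfolding fwd_diff_def by measurable
  obtain k where k: "r = Suc k" using r by (cases r) auto
  let ?I = "integral {0..\<delta>} (\<lambda>u. \<bar>?D u\<bar>)"
  have "\<bar>(sliding_int \<delta> (1 / real r) ^^ r) ?D 0\<bar> \<le> \<delta> ^ k / (1 / real r) * ?I"
    using abs_sliding_int_pow_le_integral[OF D, of "1 / real r" \<delta> k 0] r \<delta> by (simp add: k)
  then have "\<delta> powi (- int r) * \<bar>(sliding_int \<delta> (1 / real r) ^^ r) ?D 0\<bar> \<le> \<delta> powi (- int r) * (\<delta> ^ k / (1 / real r) * ?I)"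
    using \<delta> by (intro mult_left_mono) auto
  also have "\<dots> = real r / \<delta> * ?I"
  proof -
    have "\<delta> powi (- int r) = 1 / (\<delta> ^ k * \<delta>)"
      by (simp only: power_int_minus power_int_of_nat) (simp add: k field_simps)
    then show ?thesis using \<delta> by simp
  qed
  also have "\<dots> \<le> real r / \<delta> * \<bar>?I\<bar>" using \<delta> by (intro mult_left_mono) auto
  finally have "\<bar>steklov a b \<delta> r g x - g x\<bar> \<le> real r / \<delta> * \<bar>?I\<bar>"
    unfolding steklov_minus_eq_sliding_int[OF r \<delta> g(2)] using \<delta> by (simp add: abs_mult power_int_minus power_abs)
  then have "ennreal (\<bar>steklov a b \<delta> r g x - g x\<bar> powr p) \<le> ennreal ((real r / \<delta> * \<bar>?I\<bar>) powr p)"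
    using p \<delta> by (intro ennreal_leI powr_mono2) auto
  also have "\<dots> = ennreal ((real r / \<delta>) powr p) * ennreal (\<bar>?I\<bar> powr p)"
    using \<delta> by (subst powr_mult) (auto simp: ennreal_mult)
  also have "?I = (LINT u:{0..\<delta>}|lebesgue. \<bar>?D u\<bar>)"
    by (rule set_lebesgue_integral_eq_integral(2)[OF locally_integrableD[OF locally_integrable_abs[OF D]], symmetric])
  also have "ennreal ((real r / \<delta>) powr p) * ennreal (\<bar>\<dots>\<bar> powr p) \<le> ennreal ((real r / \<delta>) powr p) *
      (ennreal (\<delta> powr (p - 1)) * (\<integral>\<^sup>+u. indicator {0..\<delta>} u * ennreal (\<bar>\<bar>?D u\<bar>\<bar> powr p) \<partial>lborel))"
    using \<delta> by (intro mult_left_mono ennreal_powr_integral_Icc_le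
        locally_integrableD[OF locally_integrable_abs[OF D]] Db p) auto
  also have "\<dots> = ennreal (real r powr p / \<delta>) * (\<integral>\<^sup>+u. indicator {0..\<delta>} u * ennreal (\<bar>?D u\<bar> powr p) \<partial>lborel)"
    using \<delta> by (simp add: mult.assoc[symmetric] ennreal_mult[symmetric] powr_divide powr_diff)
  finally show ?thesis .
qed

text \<open>
  After the substitution \<open>h = u - k x\<close>, Tonelli's theorem permits integrating over \<open>x\<close> first, with \<open>h\<close> fixed.
  The condition \<open>h + k x \<in> {0..\<delta>}\<close> then confines \<open>x\<close> to an interval on which the difference
  with step \<open>h\<close> has norm at most \<open>\<Omega>\<close>. For negative \<open>h\<close> it is, up to sign, a translate of the
  difference with step \<open>- h\<close>.
\<close>
lemma steklov_minus_Lp_le: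
  fixes g :: "real \<Rightarrow> real"
  assumes ab: "a < b" and r: "1 \<le> r" and p: "1 \<le> p" and \<delta>: "0 < \<delta>" "real r * \<delta> \<le> b - a"
    and g: "g \<in> borel_measurable borel" "locally_integrable g"
    and meas: "(\<lambda>x. steklov a b \<delta> r g x - g x) \<in> borel_measurable (lebesgue_on {a..b})"
    and om: "\<And>h. 0 < h \<Longrightarrow> h \<le> \<delta> \<Longrightarrow> Lp_le p (lebesgue_on {a..b - real r * h}) (fwd_diff r h g) \<Omega>"
  shows "Lp_le p (lebesgue_on {a..b}) (\<lambda>x. steklov a b \<delta> r g x - g x) (2 * real r * \<Omega>)"
proof -
  have \<Omega>: "0 \<le> \<Omega>" using om[of \<delta>] \<delta> by (simp add: Lp_le_def)
  have [measurable]: "g \<in> borel_measurable borel" by fact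
  define k where "k = steklov_offset a b \<delta>"
  have [measurable]: "k \<in> borel_measurable borel" unfolding k_def steklov_offset_def by measurable
  have k: "0 \<le> k x" "k x \<le> \<delta>" if "x \<in> {a..b}" for x
  proof -
    have q: "0 \<le> (x - a) / (b - a)" "(x - a) / (b - a) \<le> 1" using that ab by auto
    show "0 \<le> k x"
      unfolding k_def steklov_offset_def using mult_nonneg_nonneg[OF q(1), of \<delta>] \<delta> by linarith
    show "k x \<le> \<delta>"
      unfolding k_def steklov_offset_def using mult_right_mono[OF q(2), of \<delta>] \<delta> by linarith
  qed
  \<comment> \<open>a backward step \<open>y\<close> that is admissible at \<open>x\<close> leaves room for \<open>r\<close> steps to the left of \<open>x\<close>; here \<open>r * \<delta> \<le> b - a\<close> enters\<close>
  have dil: "y * real r \<le> x - a" if "y \<le> k x" "0 \<le> y" for x y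
  proof -
    have "y * (b - a) \<le> (x - a) * \<delta>"
      using that(1) ab by (simp add: k_def steklov_offset_def field_simps)
    moreover have "y * (real r * \<delta>) \<le> y * (b - a)" using \<delta>(2) that(2) by (rule mult_left_mono)
    ultimately have "y * real r * \<delta> \<le> (x - a) * \<delta>" by (simp add: mult.assoc)
    then show ?thesis using \<delta>(1) by simp
  qed
  \<comment> \<open>and an admissible forward step for \<open>r\<close> steps to the right\<close>
  have dil': "y * real r \<le> b - x" if "y \<le> \<delta> - k x" "0 \<le> y" for x y
  proof -
    have "y * (b - a) \<le> (b - x) * \<delta>"
      using that(1) ab by (simp add: k_def steklov_offset_def field_simps)
    moreover have "y * (real r * \<delta>) \<le> y * (b - a)" using \<delta>(2) that(2) by (rule mult_left_mono)
    ultimately have "y * real r * \<delta> \<le> (b - x) * \<delta>" by (simp add: mult.assoc)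
    then show ?thesis using \<delta>(1) by simp
  qed
  define F where "F x h = indicator {a..b} x * (indicator {0..\<delta>} (h + k x) * ennreal (\<bar>fwd_diff r h g x\<bar> powr p))" for x h
  have [measurable]: "(\<lambda>(x, h). F x h) \<in> borel_measurable (lborel \<Otimes>\<^sub>M lborel)"
    unfolding F_def fwd_diff_def by measurable
  have slice: "(\<integral>\<^sup>+x. F x h \<partial>lborel) \<le> indicator {-\<delta>..\<delta>} h * ennreal (\<Omega> powr p)" if h: "h \<noteq> 0" for h
  proof -
    consider "0 < h" "h \<le> \<delta>" | "h < 0" "- h \<le> \<delta>" | "\<bar>h\<bar> > \<delta>" using h by linarith
    then show ?thesis
    proof cases
      case 1
      have "(\<integral>\<^sup>+x. F x h \<partial>lborel) \<le> (\<integral>\<^sup>+x. indicator {a..b - real r * h} x * ennreal (\<bar>fwd_diff r h g x\<bar> powr p) \<partial>lborel)"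
      proof (rule nn_integral_mono)
        fix x
        show "F x h \<le> indicator {a..b - real r * h} x * ennreal (\<bar>fwd_diff r h g x\<bar> powr p)"
        proof (cases "x \<in> {a..b} \<and> h + k x \<in> {0..\<delta>}")
          case True
          then have "x \<in> {a..b - real r * h}" using dil'[of h x] 1 by (auto simp: mult.commute)
          then show ?thesis using True by (simp add: F_def)
        qed (auto simp: F_def)
      qed
      also have "\<dots> \<le> ennreal (\<Omega> powr p)"
        using om[OF 1] by (subst (asm) Lp_le_borel_iff) auto
      finally show ?thesis using 1 by simp
    next
      case 2
      define h' where "h' = - h"
      have h': "0 < h'" "h' \<le> \<delta>" "h = - h'" using 2 by (auto simp: h'_def)
      have eq: "\<bar>fwd_diff r h g x\<bar> = \<bar>fwd_diff r h' g (x + - (real r * h'))\<bar>" for x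
        unfolding h'(3) fwd_diff_uminus_step by (simp add: abs_mult power_abs)
      have "(\<integral>\<^sup>+x. F x h \<partial>lborel) \<le> (\<integral>\<^sup>+x. indicator {a + real r * h'..b} x *
          ennreal (\<bar>fwd_diff r h' g (x + - (real r * h'))\<bar> powr p) \<partial>lborel)"
      proof (intro nn_integral_mono)
        fix x
        show "F x h \<le> indicator {a + real r * h'..b} x * ennreal (\<bar>fwd_diff r h' g (x + - (real r * h'))\<bar> powr p)"
        proof (cases "x \<in> {a..b} \<and> h + k x \<in> {0..\<delta>}")
          case True
          then have "x \<in> {a + real r * h'..b}" using dil[of h' x] h' by (auto simp: mult.commute)
          then show ?thesis using True by (simp add: F_def eq)
        qed (auto simp: F_def)
      qed
      also have "\<dots> \<le> ennreal (\<Omega> powr p)"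
      proof -
        have "Lp_le p (lebesgue_on {a + real r * h'..b}) (\<lambda>x. fwd_diff r h' g (x + - (real r * h'))) \<Omega>"
          using om[OF h'(1,2)] by (intro Lp_le_shift p) auto
        then show ?thesis by (subst (asm) Lp_le_borel_iff) auto
      qed
      finally show ?thesis using 2 \<delta> by simp
    next
      case 3
      have "F x h = 0" for x
        using 3 k[of x] by (auto simp: F_def indicator_def)
      then show ?thesis by simp
    qed
  qed
  have inner: "(\<integral>\<^sup>+u. indicator {0..\<delta>} u * ennreal (\<bar>fwd_diff r (u - k x) g x\<bar> powr p) \<partial>lborel) =
     (\<integral>\<^sup>+h. indicator {0..\<delta>} (h + k x) * ennreal (\<bar>fwd_diff r h g x\<bar> powr p) \<partial>lborel)" for x
  proof -
    have "(\<lambda>u. indicator {0..\<delta>} u * ennreal (\<bar>fwd_diff r (u - k x) g x\<bar> powr p)) \<in> borel_measurable borel"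
      unfolding fwd_diff_def by measurable
    from nn_integral_real_affine[OF this, of 1 "k x"] show ?thesis by (simp add: add.commute)
  qed
  have "(\<integral>\<^sup>+x. ennreal (\<bar>steklov a b \<delta> r g x - g x\<bar> powr p) \<partial>lebesgue_on {a..b}) =
     (\<integral>\<^sup>+x. indicator {a..b} x * ennreal (\<bar>steklov a b \<delta> r g x - g x\<bar> powr p) \<partial>lborel)"
    by (simp add: nn_integral_restrict_space nn_integral_completion mult.commute)
  also have "\<dots> \<le> (\<integral>\<^sup>+x. indicator {a..b} x * (ennreal (real r powr p / \<delta>) *
     (\<integral>\<^sup>+h. indicator {0..\<delta>} (h + k x) * ennreal (\<bar>fwd_diff r h g x\<bar> powr p) \<partial>lborel)) \<partial>lborel)"
    by (intro nn_integral_mono mult_left_mono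
        ennreal_steklov_minus_le[OF r \<delta>(1) p g, of a b, folded k_def, unfolded inner]) simp
  also have "\<dots> = (\<integral>\<^sup>+x. ennreal (real r powr p / \<delta>) * (\<integral>\<^sup>+h. F x h \<partial>lborel) \<partial>lborel)"
  proof (intro nn_integral_cong)
    fix x
    have [measurable]: "(\<lambda>h. fwd_diff r h g x) \<in> borel_measurable borel" unfolding fwd_diff_def by measurable
    show "indicator {a..b} x * (ennreal (real r powr p / \<delta>) *
       (\<integral>\<^sup>+h. indicator {0..\<delta>} (h + k x) * ennreal (\<bar>fwd_diff r h g x\<bar> powr p) \<partial>lborel)) =
       ennreal (real r powr p / \<delta>) * (\<integral>\<^sup>+h. F x h \<partial>lborel)"
      unfolding F_def by (subst nn_integral_cmult) (auto simp: mult.left_commute)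
  qed
  also have "\<dots> = ennreal (real r powr p / \<delta>) * (\<integral>\<^sup>+x. (\<integral>\<^sup>+h. F x h \<partial>lborel) \<partial>lborel)"
    by (rule nn_integral_cmult) measurable
  also have "(\<integral>\<^sup>+x. (\<integral>\<^sup>+h. F x h \<partial>lborel) \<partial>lborel) = (\<integral>\<^sup>+h. (\<integral>\<^sup>+x. F x h \<partial>lborel) \<partial>lborel)"
    by (rule lborel_pair.Fubini'[symmetric]) measurable
  also have "\<dots> \<le> (\<integral>\<^sup>+h. indicator {-\<delta>..\<delta>} h * ennreal (\<Omega> powr p) \<partial>lborel)"
    using AE_lborel_singleton[of "0::real"] by (intro nn_integral_mono_AE) (auto elim!: eventually_mono intro: slice)
  also have "\<dots> = ennreal (2 * \<delta> * \<Omega> powr p)"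
    using \<delta> by (simp add: nn_integral_multc ennreal_mult)
  also have "ennreal (real r powr p / \<delta>) * \<dots> = ennreal (2 * (real r * \<Omega>) powr p)"
    using \<delta> \<Omega> by (simp add: ennreal_mult[symmetric] powr_mult)
  also have "\<dots> \<le> ennreal ((2 * real r * \<Omega>) powr p)"
  proof (rule ennreal_leI)
    have "(2::real) powr 1 \<le> 2 powr p" using p by (intro powr_mono) auto
    then have "2 * (real r * \<Omega>) powr p \<le> 2 powr p * (real r * \<Omega>) powr p" by (intro mult_right_mono) auto
    also have "\<dots> = (2 * real r * \<Omega>) powr p" using \<Omega> by (simp add: powr_mult)
    finally show "2 * (real r * \<Omega>) powr p \<le> (2 * real r * \<Omega>) powr p" .
  qed
  finally show ?thesis using meas \<Omega> by (simp add: Lp_le_def mult_left_mono)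
qed

section \<open>From Borel to Lebesgue measurable functions\<close>

lemma AE_affine_not_in_null:
  fixes N :: "real set"
  assumes "N \<in> null_sets lborel" "c \<noteq> 0"
  shows "AE x in lborel. t + c * x \<notin> N"
  using assms by (intro AE_borel_affine[of c "\<lambda>x. x \<notin> N"]) (auto simp: AE_not_in null_sets_def)

text \<open>
  For a fixed step only finitely many translates of the null set have to be avoided.
\<close>
lemma modulus_smoothness_cong_AE:
  assumes N: "N \<in> null_sets lborel" and eq: "\<And>t. t \<notin> N \<Longrightarrow> t \<in> {a..b} \<Longrightarrow> f t = g t"
  shows "modulus_smoothness s p a b f \<eta> = modulus_smoothness s p a b g \<eta>"
  unfolding modulus_smoothness_def
proof (rule SUP_cong[OF refl])
  fix h assume h: "h \<in> {0<..\<eta>}"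
  have "AE x in lborel. \<forall>k\<in>{0..s}. x + real k * h \<notin> N"
  proof (intro AE_finite_allI)
    fix k
    show "AE x in lborel. x + real k * h \<notin> N"
      using AE_affine_not_in_null[OF N, of 1 "real k * h"] by (simp add: add.commute)
  qed simp
  then have "AE x in lebesgue. \<forall>k\<in>{0..s}. x + real k * h \<notin> N" by (rule AE_completion)
  then have "AE x in lebesgue. indicator {a..b - real s * h} x *\<^sub>R (\<bar>fwd_diff s h f x\<bar> powr p) =
      indicator {a..b - real s * h} x *\<^sub>R (\<bar>fwd_diff s h g x\<bar> powr p)"
  proof eventually_elim
    case (elim x)
    have "fwd_diff s h f x = fwd_diff s h g x" if x: "x \<in> {a..b - real s * h}"
      unfolding fwd_diff_def
    proof (rule sum.cong[OF refl])
      fix k assume k: "k \<in> {0..s}"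
      have "0 \<le> real k * h" "real k * h \<le> real s * h" using k h by (auto intro: mult_right_mono)
      then have "x + real k * h \<in> {a..b}" using x by auto
      then show "real (s choose k) * (-1) ^ (s - k) * f (x + real k * h) = real (s choose k) * (-1) ^ (s - k) * g (x + real k * h)"
        using eq elim k by simp
    qed
    then show ?case by (auto simp: indicator_def)
  qed
  then have "(LINT x:{a..b - real s * h}|lebesgue. \<bar>fwd_diff s h f x\<bar> powr p) =
      (LINT x:{a..b - real s * h}|lebesgue. \<bar>fwd_diff s h g x\<bar> powr p)"
    unfolding set_lebesgue_integral_def by (rule integral_lebesgue_cong_AE)
  then show "(LINT x:{a..b - real s * h}|lebesgue. \<bar>fwd_diff s h f x\<bar> powr p) powr (1 / p) =
      (LINT x:{a..b - real s * h}|lebesgue. \<bar>fwd_diff s h g x\<bar> powr p) powr (1 / p)" by simp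
qed

lemma sliding_int_pow_cong_AE:
  assumes d: "0 < d" and uv: "AE t in lborel. t \<in> {y..y + real (Suc k) * (d * \<delta>)} \<longrightarrow> u t = v t"
  shows "(sliding_int \<delta> d ^^ Suc k) u y = (sliding_int \<delta> d ^^ Suc k) v y"
  using uv
proof (induction k arbitrary: y)
  case 0
  then show ?case using sliding_int_cong_AE[OF d, of y \<delta> u v] by simp
next
  case (Suc k)
  have "(sliding_int \<delta> d ^^ Suc k) u (y + d * t) = (sliding_int \<delta> d ^^ Suc k) v (y + d * t)" if t: "t \<in> {0..\<delta>}" for t
  proof (rule Suc.IH)
    have "0 \<le> d * t" "d * t \<le> d * \<delta>" using t d by auto
    then have "{y + d * t..y + d * t + real (Suc k) * (d * \<delta>)} \<subseteq> {y..y + real (Suc (Suc k)) * (d * \<delta>)}"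
      by (auto simp: algebra_simps)
    then show "AE x in lborel. x \<in> {y + d * t..y + d * t + real (Suc k) * (d * \<delta>)} \<longrightarrow> u x = v x"
      using Suc.prems by (auto elim!: eventually_mono)
  qed
  then have "sliding_int \<delta> d ((sliding_int \<delta> d ^^ Suc k) u) y = sliding_int \<delta> d ((sliding_int \<delta> d ^^ Suc k) v) y"
    unfolding sliding_int_def[of \<delta> d "(sliding_int \<delta> d ^^ Suc k) u"] sliding_int_def[of \<delta> d "(sliding_int \<delta> d ^^ Suc k) v"]
    by (intro set_lebesgue_integral_cong) auto
  then show ?case by (simp only: funpow.simps(2)[of "Suc k"] o_apply)
qed

lemma iter_integral_sum_list:
  "iter_integral \<delta> r (\<lambda>ts. u (z + d * sum_list ts)) = (sliding_int \<delta> d ^^ r) u z"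
proof (induction r arbitrary: z)
  case (Suc r)
  have "iter_integral \<delta> r (\<lambda>ts. u (z + d * (t + sum_list ts))) = (sliding_int \<delta> d ^^ r) u (z + d * t)" for t
    using Suc[of "z + d * t"] by (simp add: algebra_simps)
  then show ?case
    unfolding funpow.simps o_apply iter_integral.simps sliding_int_def[of \<delta> d "(sliding_int \<delta> d ^^ r) u"] by simp
qed simp

text \<open>
  Unlike \<open>f\<close> itself, its Steklov average is determined at every single point by \<open>f\<close> up to null
  sets: each of the terms \<open>m = 1, \<dots>, r\<close> depends on the variable of integration through an
  affine map of slope \<open>m \<noteq> 0\<close>, which pulls null sets back to null sets.
\<close>
lemma steklov_cong_AE:
  assumes N: "N \<in> null_sets lborel" and eq: "\<And>t. t \<notin> N \<Longrightarrow> t \<in> {a..b} \<Longrightarrow> f t = g t"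
    and ab: "a < b" and r: "1 \<le> r" and \<delta>: "0 < \<delta>" "real r * \<delta> \<le> b - a" and x: "x \<in> {a..b}"
  shows "steklov a b \<delta> r f x = steklov a b \<delta> r g x"
proof -
  let ?q = "(x - a) / (b - a)"
  define E where "E v u = (\<Sum>m=1..r. (-1) ^ (r - m + 1) * real (r choose (r - m)) * v (x + real m * (u - ?q * \<delta>)))"
    for v :: "real \<Rightarrow> real" and u
  obtain k where k: "r = Suc k" using r by (cases r) auto
  have st: "steklov a b \<delta> r v x = (- \<delta>) powi (- int r) * (sliding_int \<delta> (1 / real r) ^^ r) (E v) 0" for v
    unfolding iter_integral_sum_list[symmetric] by (simp add: steklov_def steklov_theta_def E_def)
  have q: "0 \<le> ?q" "?q \<le> 1" "?q * (b - a) = x - a" using x ab by auto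
  \<comment> \<open>so that \<open>f\<close> is only evaluated where it agrees with \<open>g\<close>\<close>
  have inside: "x + real m * (u - ?q * \<delta>) \<in> {a..b}" if "m \<in> {1..r}" "u \<in> {0..\<delta>}" for m u
  proof -
    have "real m * \<delta> \<le> real r * \<delta>" using that \<delta> by (intro mult_right_mono) auto
    then have m: "real m * \<delta> \<le> b - a" using \<delta> by linarith
    have 1: "real m * \<delta> * ?q \<le> (b - a) * ?q" using m q(1) by (rule mult_right_mono)
    have 2: "real m * \<delta> * (1 - ?q) \<le> (b - a) * (1 - ?q)" using m q(2) by (intro mult_right_mono) auto
    have 3: "0 \<le> real m * u" "real m * u \<le> real m * \<delta>" using that by (auto intro: mult_left_mono)
    have 4: "real m * (u - ?q * \<delta>) = real m * u - real m * \<delta> * ?q" by (simp add: algebra_simps)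
    have 5: "(b - a) * ?q = x - a" using q(3) by (simp only: mult.commute)
    have 6: "real m * \<delta> * (1 - ?q) = real m * \<delta> - real m * \<delta> * ?q" "(b - a) * (1 - ?q) = (b - a) - (b - a) * ?q"
      by (simp_all only: right_diff_distrib mult_1_right)
    have "a - x \<le> real m * (u - ?q * \<delta>)" "real m * (u - ?q * \<delta>) \<le> b - x"
      using 1 2 3 unfolding 4 5 6 by linarith+
    then show ?thesis by simp
  qed
  have "AE u in lborel. \<forall>m\<in>{1..r}. (x - real m * (?q * \<delta>)) + real m * u \<notin> N"
    by (intro AE_finite_allI AE_affine_not_in_null[OF N]) auto
  then have "AE u in lborel. u \<in> {0..0 + real (Suc k) * (1 / real r * \<delta>)} \<longrightarrow> E f u = E g u"
  proof eventually_elim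
    case (elim u)
    show ?case
    proof
      assume "u \<in> {0..0 + real (Suc k) * (1 / real r * \<delta>)}"
      then have u: "u \<in> {0..\<delta>}" by (simp add: k)
      have "f (x + real m * (u - ?q * \<delta>)) = g (x + real m * (u - ?q * \<delta>))" if m: "m \<in> {1..r}" for m
      proof (rule eq)
        have "x + real m * (u - ?q * \<delta>) = (x - real m * (?q * \<delta>)) + real m * u"
          by (simp only: right_diff_distrib)
        then show "x + real m * (u - ?q * \<delta>) \<notin> N" using elim m by metis
      qed (rule inside[OF m u])
      then show "E f u = E g u" unfolding E_def by (intro sum.cong) auto
    qed
  qed
  then have "(sliding_int \<delta> (1 / real r) ^^ Suc k) (E f) 0 = (sliding_int \<delta> (1 / real r) ^^ Suc k) (E g) 0"
    using r by (intro sliding_int_pow_cong_AE) auto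
  then show ?thesis unfolding st by (simp only: k)
qed

text \<open>
  The Borel function is chosen to vanish outside \<open>{a..b}\<close>, which makes it locally integrable on the whole line.
\<close>
lemma Lp_space_borel_version:
  assumes f: "f \<in> Lp_space p a b" and p: "1 \<le> p"
  obtains g N where "g \<in> borel_measurable borel" "locally_integrable g" "N \<in> null_sets lborel"
    "\<And>t. t \<notin> N \<Longrightarrow> t \<in> {a..b} \<Longrightarrow> f t = g t"
    "Lp_le p (lebesgue_on {a..b}) g (Lp_norm p a b f)"
proof -
  have fm: "f \<in> borel_measurable (lebesgue_on {a..b})" using f by (simp add: Lp_space_def)
  have "(\<lambda>x. if x \<in> {a..b} then f x else 0) \<in> borel_measurable (completion lborel)"
    by (rule borel_measurable_if_I[OF fm]) simp
  from completion_ex_borel_measurable_real[OF this]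
  obtain g0 where g0: "g0 \<in> borel_measurable lborel" "AE x in lborel. (if x \<in> {a..b} then f x else 0) = g0 x"
    by blast
  obtain N where N: "N \<in> null_sets lborel" "\<And>x. x \<notin> N \<Longrightarrow> (if x \<in> {a..b} then f x else 0) = g0 x"
    using g0(2) by (auto elim!: AE_E3)
  define g where "g x = indicator {a..b} x * g0 x" for x
  have gb: "g \<in> borel_measurable borel" using g0(1) unfolding g_def by measurable
  have eq: "f t = g t" if "t \<notin> N" "t \<in> {a..b}" for t
    using N(2)[OF that(1)] that(2) by (simp add: g_def)
  have gm: "g \<in> borel_measurable (lebesgue_on {a..b})"
  proof (rule measurable_restrict_space1)
    show "g \<in> borel_measurable lebesgue" using gb by (intro measurable_completion) simp
  qed
  have "AE x in lebesgue. x \<notin> N"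
    using AE_not_in[OF N(1)] by (rule AE_completion)
  then have ae: "AE x in lebesgue_on {a..b}. f x = g x"
    by (subst AE_restrict_space_iff) (auto elim!: eventually_mono intro: eq)
  have "Lp_le p (lebesgue_on {a..b}) f (Lp_norm p a b f)"
    using Lp_le_iff_Lp_space[OF p] f by blast
  then have L: "Lp_le p (lebesgue_on {a..b}) g (Lp_norm p a b f)"
    by (rule Lp_le_cong_AE[OF _ ae gm])
  then have "g absolutely_integrable_on {a..b}"
    using Lp_le_iff_Lp_space[OF p] p by (blast intro: Lp_space_imp_absolutely_integrable)
  then have "integrable lebesgue (\<lambda>x. indicator {a..b} x *\<^sub>R g x)" by (simp add: set_integrable_def)
  moreover have "(\<lambda>x. indicator {a..b} x *\<^sub>R g x) = g" by (auto simp: g_def indicator_def)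
  ultimately have "integrable lebesgue g" by simp
  then have "locally_integrable g"
    unfolding locally_integrable_def set_integrable_def by (intro allI integrable_mult_indicator) auto
  then show thesis using that gb N(1) eq L by blast
qed

text \<open>
  The smoothness and approximation estimates hold for a Borel version \<open>g\<close> of \<open>f\<close>. They carry over because
  \<open>f\<close> and \<open>g\<close> have the same modulus and their Steklov averages agree everywhere on \<open>{a..b}\<close>.
\<close>
lemma steklov_estimates:
  assumes ab: "a < b" and s: "1 \<le> s" "s \<le> r" and p: "1 \<le> p" and \<delta>: "0 < \<delta>" "real r * \<delta> \<le> b - a" "\<delta> \<le> \<eta>"
    and f: "f \<in> Lp_space p a b"
  defines "\<omega> \<equiv> modulus_smoothness s p a b f \<eta>"
  shows "0 \<le> \<omega>"
    and "steklov a b \<delta> r f \<in> Sobolev_space s p a b"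
    and "Lp_norm p a b (iter_deriv a b s (steklov a b \<delta> r f)) \<le> 2 ^ r * real r ^ s / \<delta> ^ s * \<omega>"
    and "Lp_le p (lebesgue_on {a..b}) (\<lambda>x. steklov a b \<delta> r f x - f x) (2 * real r * 2 ^ (r - s) * \<omega>)"
proof -
  have r: "1 \<le> r" using s by simp
  obtain g N where g: "g \<in> borel_measurable borel" "locally_integrable g" and N: "N \<in> null_sets lborel"
    and eq: "\<And>t. t \<notin> N \<Longrightarrow> t \<in> {a..b} \<Longrightarrow> f t = g t"
    and L: "Lp_le p (lebesgue_on {a..b}) g (Lp_norm p a b f)"
    using Lp_space_borel_version[OF f p] by blast
  have \<omega>: "\<omega> = modulus_smoothness s p a b g \<eta>"
    unfolding \<omega>_def by (rule modulus_smoothness_cong_AE[OF N eq])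
  have om: "Lp_le p (lebesgue_on {a..b - real s * h}) (fwd_diff s h g) \<omega>" if "0 < h" "h \<le> \<delta>" for h
    unfolding \<omega> using that \<delta> by (intro fwd_diff_le_modulus[OF g(1) p L]) auto
  show "0 \<le> \<omega>" using om[of \<delta>] \<delta> by (simp add: Lp_le_def)
  have st: "steklov a b \<delta> r f x = steklov a b \<delta> r g x" if "x \<in> {a..b}" for x
    by (rule steklov_cong_AE[OF N eq ab r \<delta>(1,2) that])
  show "steklov a b \<delta> r f \<in> Sobolev_space s p a b"
    by (rule steklov_Sobolev_space(1)[OF ab s p \<delta>(1,2) g om st])
  show "Lp_norm p a b (iter_deriv a b s (steklov a b \<delta> r f)) \<le> 2 ^ r * real r ^ s / \<delta> ^ s * \<omega>"
    by (rule steklov_Sobolev_space(2)[OF ab s p \<delta>(1,2) g om st])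
  have om': "Lp_le p (lebesgue_on {a..b - real r * h}) (fwd_diff r h g) (2 ^ (r - s) * \<omega>)" if "0 < h" "h \<le> \<delta>" for h
    using Lp_le_fwd_diff_raise[OF g(1) p that(1) om[OF that], of "r - s"] s by simp
  have "(\<lambda>x. steklov a b \<delta> r g x - g x) \<in> borel_measurable borel"
  proof -
    have [measurable]: "(sliding_int \<delta> (real m / real r) ^^ r) g \<in> borel_measurable borel" if "m \<in> {1..r}" for m
      using that g \<delta> by (intro borel_measurable_sliding_int_pow) auto
    have [measurable]: "g \<in> borel_measurable borel" by fact
    show ?thesis unfolding steklov_eq_sum_sliding_int[OF ab r \<delta>(1) g(2)] by measurable
  qed
  then have meas: "(\<lambda>x. steklov a b \<delta> r g x - g x) \<in> borel_measurable (lebesgue_on {a..b})"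
    by (intro measurable_restrict_space1 measurable_completion) simp
  have L1: "Lp_le p (lebesgue_on {a..b}) (\<lambda>x. steklov a b \<delta> r g x - g x) (2 * real r * (2 ^ (r - s) * \<omega>))"
    by (rule steklov_minus_Lp_le[OF ab r p \<delta>(1,2) g meas om'])
  have AE: "AE x in lebesgue_on {a..b}. steklov a b \<delta> r g x - g x = steklov a b \<delta> r f x - f x"
  proof -
    have "AE x in lebesgue. x \<notin> N" using AE_not_in[OF N] by (rule AE_completion)
    then show ?thesis
      by (subst AE_restrict_space_iff) (auto elim!: eventually_mono simp: eq st)
  qed
  have meas': "(\<lambda>x. steklov a b \<delta> r f x - f x) \<in> borel_measurable (lebesgue_on {a..b})"
    by (rule borel_measurable_lebesgue_on_AE[OF meas _ AE]) simp
  show "Lp_le p (lebesgue_on {a..b}) (\<lambda>x. steklov a b \<delta> r f x - f x) (2 * real r * 2 ^ (r - s) * \<omega>)"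
    using Lp_le_cong_AE[OF L1 AE meas'] by (simp only: mult.assoc)
qed

section \<open>Sampling operators\<close>

lemma sampling_op_diff:
  "sampling_op x \<phi> n (\<lambda>y. u y - v y) = (\<lambda>y. sampling_op x \<phi> n u y - sampling_op x \<phi> n v y)"
  by (auto simp: sampling_op_def left_diff_distrib sum_subtractf)

theorem theorem3p5:
  fixes a b p \<gamma> K1 K3 :: real
    and r s :: nat
    and x :: "nat \<Rightarrow> nat \<Rightarrow> real"
    and \<phi> :: "nat \<Rightarrow> nat \<Rightarrow> real \<Rightarrow> real"
  assumes "a < b"
    and "1 \<le> s" and "s \<le> r"
    and "1 \<le> p"
    and "0 < \<gamma>" and "\<gamma> \<le> 1"
    and nodes_in: "\<And>n k. 1 \<le> n \<Longrightarrow> k \<le> n \<Longrightarrow> x k n \<in> {a..b}"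
    and nodes_increasing: "\<And>n k. 1 \<le> n \<Longrightarrow> k < n \<Longrightarrow> x k n < x (k + 1) n"
    and nodes_separated:
      "\<And>n. 1 \<le> n \<Longrightarrow> (MIN k\<in>{0..n}. ext_node a b x (k + 1) n - ext_node a b x k n) \<ge> \<gamma> / real n"
    and "K1 > 0" and "K3 > 0"
    and G_bounded:
      "\<And>n f. 1 \<le> n \<Longrightarrow> f \<in> Lp_space p a b \<Longrightarrow>
         sampling_op x \<phi> n f \<in> Lp_space p a b \<and>
         Lp_norm p a b (sampling_op x \<phi> n f) \<le> K1 * lp_seminorm p a b x n f"
    and G_Jackson:
      "\<And>n f. 1 \<le> n \<Longrightarrow> f \<in> Sobolev_space s p a b \<Longrightarrow>
         Lp_norm p a b (\<lambda>y. f y - sampling_op x \<phi> n f y)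
           \<le> K3 * real n powi (- int s) * Lp_norm p a b (iter_deriv a b s f)"
  shows "\<exists>C1>0.
    (\<forall>f\<in>Lp_space p a b. \<forall>n\<ge>1. \<gamma> / real n \<le> (b - a) / real r \<longrightarrow>
       Lp_norm p a b (\<lambda>y. f y - sampling_op x \<phi> n f y)
         \<le> K1 * lp_seminorm p a b x n (\<lambda>y. steklov a b (\<gamma> / real n) r f y - f y)
           + C1 * modulus_smoothness s p a b f (1 / real n) \<and>
       Lp_norm p a b (\<lambda>y. f y - sampling_op x \<phi> n f y)
         \<le> max K1 C1 * semidiscrete_modulus r s p a b x \<gamma> n f) \<and>
    (\<forall>K2>0.
       (\<forall>f\<in>Lp_space p a b. \<forall>n\<ge>1.
          K2 * lp_seminorm p a b x n f \<le> Lp_norm p a b (sampling_op x \<phi> n f)) \<longrightarrow>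
       (\<forall>f\<in>Lp_space p a b. \<forall>n\<ge>1. \<gamma> / real n \<le> (b - a) / real r \<longrightarrow>
          K2 * lp_seminorm p a b x n (\<lambda>y. steklov a b (\<gamma> / real n) r f y - f y)
            - C1 * modulus_smoothness s p a b f (1 / real n)
          \<le> Lp_norm p a b (\<lambda>y. f y - sampling_op x \<phi> n f y)))"
proof -
  \<comment> \<open>the first summand bounds \<open>F - f\<close>, the second \<open>F - G F\<close>\<close>
  define C1 where "C1 = 2 * real r * 2 ^ (r - s) + K3 * (2 ^ r * real r ^ s / \<gamma> ^ s)"
  have r: "1 \<le> r" using \<open>1 \<le> s\<close> \<open>s \<le> r\<close> by simp
  have C1: "0 < C1"
    using r \<open>K3 > 0\<close> \<open>0 < \<gamma>\<close> unfolding C1_def by (intro add_pos_nonneg) auto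
  note iff = Lp_le_iff_Lp_space[OF \<open>1 \<le> p\<close>]
  note add = Lp_le_add[OF _ _ \<open>1 \<le> p\<close>] and diff = Lp_le_diff[OF _ _ \<open>1 \<le> p\<close>]
  let ?L = "Lp_le p (lebesgue_on {a..b})"
  \<comment> \<open>up to a multiple of the modulus, \<open>f - G f\<close> and \<open>G (F - f)\<close> have the same norm\<close>
  have key: "0 \<le> modulus_smoothness s p a b f (1 / real n) \<and>
     Lp_norm p a b (\<lambda>y. f y - sampling_op x \<phi> n f y)
       \<le> Lp_norm p a b (sampling_op x \<phi> n (\<lambda>y. steklov a b (\<gamma> / real n) r f y - f y))
         + C1 * modulus_smoothness s p a b f (1 / real n) \<and>
     Lp_norm p a b (sampling_op x \<phi> n (\<lambda>y. steklov a b (\<gamma> / real n) r f y - f y))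
       \<le> Lp_norm p a b (\<lambda>y. f y - sampling_op x \<phi> n f y)
         + C1 * modulus_smoothness s p a b f (1 / real n) \<and>
     (\<lambda>y. steklov a b (\<gamma> / real n) r f y - f y) \<in> Lp_space p a b"
    if f: "f \<in> Lp_space p a b" and n: "1 \<le> n" and \<delta>r: "\<gamma> / real n \<le> (b - a) / real r" for f n
  proof -
    define \<delta> where "\<delta> = \<gamma> / real n"
    define \<omega> where "\<omega> = modulus_smoothness s p a b f (1 / real n)"
    define F where "F = steklov a b \<delta> r f"
    let ?G = "sampling_op x \<phi> n"
    have \<delta>: "0 < \<delta>" "real r * \<delta> \<le> b - a" "\<delta> \<le> 1 / real n"
      using n r \<delta>r \<open>0 < \<gamma>\<close> \<open>\<gamma> \<le> 1\<close> by (auto simp: \<delta>_def field_simps)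
    note est = steklov_estimates[OF \<open>a < b\<close> \<open>1 \<le> s\<close> \<open>s \<le> r\<close> \<open>1 \<le> p\<close> \<delta> f, folded F_def \<omega>_def]
    have Ff: "?L (\<lambda>y. F y - f y) (2 * real r * 2 ^ (r - s) * \<omega>)" by (rule est(4))
    have f_le: "?L f (Lp_norm p a b f)" using f iff by blast
    have F_Lp: "F \<in> Lp_space p a b" using add[OF Ff f_le] iff by fastforce
    have G_le: "?L (?G u) (Lp_norm p a b (?G u))" if "u \<in> Lp_space p a b" for u
      using G_bounded[OF n that] iff by blast
    have Ff_Lp: "(\<lambda>y. F y - f y) \<in> Lp_space p a b" using Ff iff by blast
    have FG: "?L (\<lambda>y. F y - ?G F y) (K3 * (2 ^ r * real r ^ s / \<gamma> ^ s) * \<omega>)"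
    proof -
      have "?L F (Lp_norm p a b F)" using F_Lp iff by blast
      from diff[OF this G_le[OF F_Lp]] have "(\<lambda>y. F y - ?G F y) \<in> Lp_space p a b" using iff by blast
      moreover have "Lp_norm p a b (\<lambda>y. F y - ?G F y) \<le> K3 * real n powi (- int s) * Lp_norm p a b (iter_deriv a b s F)"
        by (rule G_Jackson[OF n est(2)])
      moreover have "\<dots> \<le> K3 * real n powi (- int s) * (2 ^ r * real r ^ s / \<delta> ^ s * \<omega>)"
        using est(3) \<open>K3 > 0\<close> by (intro mult_left_mono) auto
      moreover have "\<dots> = K3 * (2 ^ r * real r ^ s / \<gamma> ^ s) * \<omega>"
      proof -
        have "real n powi (- int s) = 1 / real n ^ s"
          by (simp only: power_int_minus power_int_of_nat inverse_eq_divide)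
        moreover have "\<delta> ^ s = \<gamma> ^ s / real n ^ s" by (simp add: \<delta>_def power_divide)
        ultimately show ?thesis using n \<open>0 < \<gamma>\<close> by simp
      qed
      ultimately show ?thesis using iff by auto
    qed
    have fG: "?L (\<lambda>y. f y - ?G f y) (Lp_norm p a b (\<lambda>y. f y - ?G f y))"
      using diff[OF f_le G_le[OF f]] iff by blast
    have C1\<omega>: "C1 * \<omega> = 2 * real r * 2 ^ (r - s) * \<omega> + K3 * (2 ^ r * real r ^ s / \<gamma> ^ s) * \<omega>"
      by (simp only: C1_def distrib_right)
    have "?L (\<lambda>y. (?G (\<lambda>y. F y - f y) y - (F y - f y)) + (F y - ?G F y))
       ((Lp_norm p a b (?G (\<lambda>y. F y - f y)) + 2 * real r * 2 ^ (r - s) * \<omega>) + K3 * (2 ^ r * real r ^ s / \<gamma> ^ s) * \<omega>)"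
      by (intro add diff G_le Ff_Lp Ff FG)
    then have "?L (\<lambda>y. - (?G f y - f y)) (Lp_norm p a b (?G (\<lambda>y. F y - f y)) + C1 * \<omega>)"
      by (simp add: sampling_op_diff C1\<omega> add.assoc)
    then have upper: "Lp_norm p a b (\<lambda>y. f y - ?G f y) \<le> Lp_norm p a b (?G (\<lambda>y. F y - f y)) + C1 * \<omega>"
      using iff by simp
    have "?L (\<lambda>y. ((f y - ?G f y) + (F y - f y)) - (F y - ?G F y))
       ((Lp_norm p a b (\<lambda>y. f y - ?G f y) + 2 * real r * 2 ^ (r - s) * \<omega>) + K3 * (2 ^ r * real r ^ s / \<gamma> ^ s) * \<omega>)"
      by (intro add diff fG Ff FG)
    then have "?L (?G (\<lambda>y. F y - f y)) (Lp_norm p a b (\<lambda>y. f y - ?G f y) + C1 * \<omega>)"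
      by (simp add: sampling_op_diff C1\<omega> add.assoc)
    then have lower: "Lp_norm p a b (?G (\<lambda>y. F y - f y)) \<le> Lp_norm p a b (\<lambda>y. f y - ?G f y) + C1 * \<omega>"
      using iff by simp
    show ?thesis
      using est(1) upper lower Ff_Lp unfolding F_def \<delta>_def \<omega>_def by blast
  qed
  show ?thesis
  proof (intro exI[of _ C1] conjI C1 ballI allI impI)
    fix f n assume f: "f \<in> Lp_space p a b" and n: "1 \<le> n" and \<delta>r: "\<gamma> / real n \<le> (b - a) / real r"
    let ?l = "lp_seminorm p a b x n (\<lambda>y. steklov a b (\<gamma> / real n) r f y - f y)"
    let ?\<omega> = "modulus_smoothness s p a b f (1 / real n)"
    note k = key[OF f n \<delta>r]
    show 1: "Lp_norm p a b (\<lambda>y. f y - sampling_op x \<phi> n f y) \<le> K1 * ?l + C1 * ?\<omega>"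
      using k G_bounded[OF n, of "\<lambda>y. steklov a b (\<gamma> / real n) r f y - f y"] by linarith
    have "K1 * ?l + C1 * ?\<omega> \<le> max K1 C1 * ?l + max K1 C1 * ?\<omega>"
      using k by (intro add_mono mult_right_mono) (auto simp: lp_seminorm_def)
    then show "Lp_norm p a b (\<lambda>y. f y - sampling_op x \<phi> n f y) \<le> max K1 C1 * semidiscrete_modulus r s p a b x \<gamma> n f"
      using 1 by (simp add: semidiscrete_modulus_def distrib_left)
  next
    fix K2 f n
    assume K2: "\<forall>f\<in>Lp_space p a b. \<forall>n\<ge>1.
          K2 * lp_seminorm p a b x n f \<le> Lp_norm p a b (sampling_op x \<phi> n f)"
      and f: "f \<in> Lp_space p a b" and n: "1 \<le> n" and \<delta>r: "\<gamma> / real n \<le> (b - a) / real r"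
    note k = key[OF f n \<delta>r]
    have "K2 * lp_seminorm p a b x n (\<lambda>y. steklov a b (\<gamma> / real n) r f y - f y)
       \<le> Lp_norm p a b (sampling_op x \<phi> n (\<lambda>y. steklov a b (\<gamma> / real n) r f y - f y))"
      using K2 k n by blast
    then show "K2 * lp_seminorm p a b x n (\<lambda>y. steklov a b (\<gamma> / real n) r f y - f y)
        - C1 * modulus_smoothness s p a b f (1 / real n) \<le> Lp_norm p a b (\<lambda>y. f y - sampling_op x \<phi> n f y)"
      using k by linarith
  qed
qed

end
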